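(* Let $m,n$ be nonzero integers, $d=\gcd(m,n)$ and $G_{m,n}=\langle x,y\mid x^m=y^n\rangle$. The number of irreducible components of the representation variety $R(G_{m,n})$ is $$\begin{cases}\dfrac{(|m|-1)(|n|-1)}{2}+\dfrac{d+1}{2} & \text{if } d\text{ is odd},\\[2mm] \dfrac{(|m|-1)(|n|-1)+1}{2}+\dfrac{d+2}{2} & \text{if } d\text{ is even},\end{cases}$$ where the first summand is the number of irreducible components of $\overline{Irr}$ and the second summand is the number of irreducible components of $Ab$.
   Context: $R(G_{m,n})=\{(\rho(x),\rho(y))\mid\rho:G_{m,n}\to SL(2,\mathbb{C})\text{ a homomorphism}\}=\{(A,B)\in SL(2,\mathbb{C})^2\mid A^m=B^n\}$, an affine algebraic set in $\mathbb{C}^8$, whose points are identified with representations. A representation is reducible if the matrices in its image share a common eigenvector, irreducible otherwise. $Irr\subseteq R(G_{m,n})$ is the set of irreducible representations, $\overline{Irr}$ its Zariski closure, and $Ab\subseteq R(G_{m,n})$ is the (Zariski closed) set of representations with abelian image. *)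

theory Defs
  imports "HOL-Analysis.Analysis" "HOL-Algebra.Group"
begin

section \<open>Groups given by a presentation\<close>

text \<open>A letter \<open>(g, True)\<close> is the generator \<open>g\<close>, and \<open>(g, False)\<close> is its formal inverse.\<close>

type_synonym 'g word = "('g \<times> bool) list"

inductive word_eq :: "('g word \<times> 'g word) set \<Rightarrow> 'g word \<Rightarrow> 'g word \<Rightarrow> bool"
  for Rel :: "('g word \<times> 'g word) set"
where
  refl: "word_eq Rel u u"
| sym: "word_eq Rel u v \<Longrightarrow> word_eq Rel v u"
| trans: "word_eq Rel u v \<Longrightarrow> word_eq Rel v w \<Longrightarrow> word_eq Rel u w"
| cong: "word_eq Rel u v \<Longrightarrow> word_eq Rel (a @ u @ b) (a @ v @ b)"
| cancel: "word_eq Rel [(g, s), (g, \<not> s)] []"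
| rel: "(u, v) \<in> Rel \<Longrightarrow> word_eq Rel u v"

definition word_class :: "('g word \<times> 'g word) set \<Rightarrow> 'g word \<Rightarrow> 'g word set" where
  "word_class Rel w = {v. word_eq Rel w v}"

definition presented_group :: "('g word \<times> 'g word) set \<Rightarrow> 'g word set monoid" where
  "presented_group Rel =
     \<lparr>carrier = range (word_class Rel),
      mult = (\<lambda>U V. \<Union>u\<in>U. \<Union>v\<in>V. word_class Rel (u @ v)),
      one = word_class Rel []\<rparr>"

definition power_word :: "'g \<Rightarrow> int \<Rightarrow> 'g word" where
  "power_word g k = replicate (nat \<bar>k\<bar>) (g, 0 \<le> k)"

lemma word_class_eq_iff: "word_class Rel u = word_class Rel v \<longleftrightarrow> word_eq Rel u v"
proof
  assume "word_class Rel u = word_class Rel v"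
  then have "v \<in> word_class Rel u" by (simp add: word_class_def word_eq.refl)
  then show "word_eq Rel u v" by (simp add: word_class_def)
next
  assume "word_eq Rel u v"
  then show "word_class Rel u = word_class Rel v"
    by (auto simp: word_class_def intro: word_eq.trans word_eq.sym)
qed

lemma word_eq_append:
  assumes "word_eq Rel u u'" "word_eq Rel v v'"
  shows "word_eq Rel (u @ v) (u' @ v')"
  using word_eq.cong[OF assms(1), of "[]" v] word_eq.cong[OF assms(2), of u' "[]"]
  by (auto intro: word_eq.trans)

lemma mult_word_class [simp]:
  "word_class Rel u \<otimes>\<^bsub>presented_group Rel\<^esub> word_class Rel v = word_class Rel (u @ v)"
proof -
  have "word_class Rel (u' @ v') = word_class Rel (u @ v)"
    if "u' \<in> word_class Rel u" "v' \<in> word_class Rel v" for u' v'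
    unfolding word_class_eq_iff using that
    by (intro word_eq.sym[OF word_eq_append])
       (simp_all add: word_class_def)
  moreover have "u \<in> word_class Rel u" "v \<in> word_class Rel v"
    by (simp_all add: word_class_def word_eq.refl)
  ultimately have "(\<Union>u'\<in>word_class Rel u. \<Union>v'\<in>word_class Rel v. word_class Rel (u' @ v'))
      = word_class Rel (u @ v)" by blast
  then show ?thesis by (simp add: presented_group_def)
qed

lemma carrier_presented_group [simp]:
  "carrier (presented_group Rel) = range (word_class Rel)"
  by (simp add: presented_group_def)

lemma one_presented_group [simp]: "\<one>\<^bsub>presented_group Rel\<^esub> = word_class Rel []"
  by (simp add: presented_group_def)

definition inverse_word :: "'g word \<Rightarrow> 'g word" where
  "inverse_word w = rev (map (\<lambda>(g, s). (g, \<not> s)) w)"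

lemma word_eq_inverse_word: "word_eq Rel (inverse_word w @ w) []"
proof (induction w)
  case Nil
  show ?case by (simp add: inverse_word_def word_eq.refl)
next
  case (Cons a w)
  obtain g s where a: "a = (g, s)" by (cases a)
  have "word_eq Rel (inverse_word w @ [(g, \<not> s), (g, \<not> \<not> s)] @ w) (inverse_word w @ [] @ w)"
    by (intro word_eq.cong word_eq.cancel)
  with Cons show ?case by (auto simp: a inverse_word_def intro: word_eq.trans)
qed

lemma group_presented_group: "group (presented_group Rel)"
proof (rule groupI)
  fix U assume "U \<in> carrier (presented_group Rel)"
  then obtain u where u: "U = word_class Rel u" by auto
  then show "\<exists>V\<in>carrier (presented_group Rel).
      V \<otimes>\<^bsub>presented_group Rel\<^esub> U = \<one>\<^bsub>presented_group Rel\<^esub>"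
    by (intro bexI[of _ "word_class Rel (inverse_word u)"])
       (auto simp: word_class_eq_iff word_eq_inverse_word)
qed auto

section \<open>The groups \<open>\<langle>x, y | x\<^sup>m = y\<^sup>n\<rangle>\<close> and their representations in \<open>SL(2,\<complex>)\<close>\<close>

datatype gen = Gen_x | Gen_y

definition relations_G :: "int \<Rightarrow> int \<Rightarrow> (gen word \<times> gen word) set" where
  "relations_G m n = {(power_word Gen_x m, power_word Gen_y n)}"

definition G_grp :: "int \<Rightarrow> int \<Rightarrow> gen word set monoid" where
  "G_grp m n = presented_group (relations_G m n)"

definition x_G :: "int \<Rightarrow> int \<Rightarrow> gen word set" where
  "x_G m n = word_class (relations_G m n) [(Gen_x, True)]"

definition y_G :: "int \<Rightarrow> int \<Rightarrow> gen word set" where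
  "y_G m n = word_class (relations_G m n) [(Gen_y, True)]"

definition SL2 :: "(complex^2^2) monoid" where
  "SL2 = \<lparr>carrier = {A. det A = 1}, mult = (**), one = mat 1\<rparr>"

definition irreducible_rep :: "('a, 'b) monoid_scheme \<Rightarrow> ('a \<Rightarrow> complex^2^2) \<Rightarrow> bool" where
  "irreducible_rep H \<rho> \<longleftrightarrow>
     \<not> (\<exists>v. v \<noteq> 0 \<and> (\<forall>g\<in>carrier H. \<exists>c. \<rho> g *v v = c *s v))"

definition abelian_image :: "('a, 'b) monoid_scheme \<Rightarrow> ('a \<Rightarrow> complex^2^2) \<Rightarrow> bool" where
  "abelian_image H \<rho> \<longleftrightarrow>
     (\<forall>g\<in>carrier H. \<forall>h\<in>carrier H. \<rho> g ** \<rho> h = \<rho> h ** \<rho> g)"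

text \<open>The affine space \<open>\<complex>\<^sup>8\<close> is the space of pairs of complex \<open>2 \<times> 2\<close> matrices.\<close>

type_synonym matrix_pair = "(complex^2^2) \<times> (complex^2^2)"

definition rep_variety :: "int \<Rightarrow> int \<Rightarrow> matrix_pair set" where
  "rep_variety m n = {(\<rho> (x_G m n), \<rho> (y_G m n)) |\<rho>. \<rho> \<in> hom (G_grp m n) SL2}"

definition Irr :: "int \<Rightarrow> int \<Rightarrow> matrix_pair set" where
  "Irr m n = {(\<rho> (x_G m n), \<rho> (y_G m n)) |\<rho>.
     \<rho> \<in> hom (G_grp m n) SL2 \<and> irreducible_rep (G_grp m n) \<rho>}"

definition Ab :: "int \<Rightarrow> int \<Rightarrow> matrix_pair set" where
  "Ab m n = {(\<rho> (x_G m n), \<rho> (y_G m n)) |\<rho>.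
     \<rho> \<in> hom (G_grp m n) SL2 \<and> abelian_image (G_grp m n) \<rho>}"

section \<open>The Zariski topology and irreducible components\<close>

inductive_set polynomial_functions :: "(matrix_pair \<Rightarrow> complex) set" where
  const: "(\<lambda>P. c) \<in> polynomial_functions"
| coord_fst: "(\<lambda>P. fst P $ i $ j) \<in> polynomial_functions"
| coord_snd: "(\<lambda>P. snd P $ i $ j) \<in> polynomial_functions"
| add: "f \<in> polynomial_functions \<Longrightarrow> g \<in> polynomial_functions \<Longrightarrow>
    (\<lambda>P. f P + g P) \<in> polynomial_functions"
| mult: "f \<in> polynomial_functions \<Longrightarrow> g \<in> polynomial_functions \<Longrightarrow>
    (\<lambda>P. f P * g P) \<in> polynomial_functions"

definition zero_locus :: "(matrix_pair \<Rightarrow> complex) set \<Rightarrow> matrix_pair set" where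
  "zero_locus F = {P. \<forall>f\<in>F. f P = 0}"

definition zariski :: "matrix_pair topology" where
  "zariski = topology (\<lambda>U. \<exists>F\<subseteq>polynomial_functions. - U = zero_locus F)"

lemma istopology_zariski:
  "istopology (\<lambda>U. \<exists>F\<subseteq>polynomial_functions. - U = zero_locus F)"
  unfolding istopology_def
proof (intro conjI allI impI)
  fix S T
  assume "\<exists>F\<subseteq>polynomial_functions. - S = zero_locus F"
    and "\<exists>F\<subseteq>polynomial_functions. - T = zero_locus F"
  then obtain F1 F2
    where F: "F1 \<subseteq> polynomial_functions" "- S = zero_locus F1"
      "F2 \<subseteq> polynomial_functions" "- T = zero_locus F2" by blast
  let ?F = "{(\<lambda>P. f P * g P) |f g. f \<in> F1 \<and> g \<in> F2}"
  have "?F \<subseteq> polynomial_functions" using F by (auto intro: polynomial_functions.mult)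
  moreover have "zero_locus ?F = zero_locus F1 \<union> zero_locus F2"
  proof
    show "zero_locus ?F \<subseteq> zero_locus F1 \<union> zero_locus F2"
    proof
      fix P assume P: "P \<in> zero_locus ?F"
      have "f P * g P = 0" if "f \<in> F1" "g \<in> F2" for f g
      proof -
        have "(\<lambda>P. f P * g P) \<in> ?F" using that by blast
        then show ?thesis using P[unfolded zero_locus_def mem_Collect_eq] by (rule bspec[rotated])
      qed
      then show "P \<in> zero_locus F1 \<union> zero_locus F2"
        unfolding zero_locus_def by fastforce
    qed
  qed (auto simp: zero_locus_def)
  ultimately show "\<exists>F\<subseteq>polynomial_functions. - (S \<inter> T) = zero_locus F"
    unfolding Compl_Int F(2,4) by (intro exI[of _ ?F]) simp
next
  fix \<K> :: "matrix_pair set set"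
  assume "\<forall>K\<in>\<K>. \<exists>F\<subseteq>polynomial_functions. - K = zero_locus F"
  then obtain F where F: "\<And>K. K \<in> \<K> \<Longrightarrow> F K \<subseteq> polynomial_functions \<and> - K = zero_locus (F K)"
    by metis
  have "- \<Union>\<K> = (\<Inter>K\<in>\<K>. - K)" by blast
  also have "\<dots> = (\<Inter>K\<in>\<K>. zero_locus (F K))" using F by (intro INF_cong) auto
  also have "\<dots> = zero_locus (\<Union>K\<in>\<K>. F K)" by (auto simp: zero_locus_def)
  finally have "- \<Union>\<K> = zero_locus (\<Union>K\<in>\<K>. F K)" .
  moreover have "(\<Union>K\<in>\<K>. F K) \<subseteq> polynomial_functions" using F by blast
  ultimately show "\<exists>F\<subseteq>polynomial_functions. - \<Union>\<K> = zero_locus F" by blast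
qed

lemma topspace_zariski [simp]: "topspace zariski = UNIV"
proof -
  have "openin zariski UNIV"
    unfolding zariski_def topology_inverse'[OF istopology_zariski]
    by (rule exI[of _ "{\<lambda>P. 1}"]) (auto simp: zero_locus_def intro: polynomial_functions.const)
  then show ?thesis using openin_subset[of zariski UNIV] by auto
qed

lemma closedin_zariski_iff:
  "closedin zariski C \<longleftrightarrow> (\<exists>F\<subseteq>polynomial_functions. C = zero_locus F)"
proof -
  have "openin zariski (- C) \<longleftrightarrow> (\<exists>F\<subseteq>polynomial_functions. C = zero_locus F)"
    unfolding zariski_def topology_inverse'[OF istopology_zariski] by simp
  then show ?thesis unfolding closedin_def topspace_zariski Compl_eq_Diff_UNIV by simp
qed

text \<open>The empty set is not irreducible, so it has no irreducible components.\<close>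

definition irreducible_in :: "'a topology \<Rightarrow> 'a set \<Rightarrow> bool" where
  "irreducible_in T S \<longleftrightarrow> S \<subseteq> topspace T \<and> S \<noteq> {} \<and>
     (\<forall>C D. closedin T C \<and> closedin T D \<and> S \<subseteq> C \<union> D \<longrightarrow> S \<subseteq> C \<or> S \<subseteq> D)"

definition irreducible_components :: "'a topology \<Rightarrow> 'a set \<Rightarrow> 'a set set" where
  "irreducible_components T S =
     {Z. Z \<subseteq> S \<and> irreducible_in T Z \<and>
         (\<forall>Z'. Z' \<subseteq> S \<and> irreducible_in T Z' \<and> Z \<subseteq> Z' \<longrightarrow> Z' = Z)}"

section \<open>The representation variety by equations\<close>

lemma group_SL2: "group SL2"
proof (rule groupI)
  fix A assume A: "A \<in> carrier SL2"
  then have "invertible A" by (simp add: SL2_def invertible_det_nz)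
  then obtain B where B: "B ** A = mat 1" unfolding invertible_def by blast
  then have "det B * det A = 1" by (metis det_I det_mul)
  with A have "B \<in> carrier SL2" by (simp add: SL2_def)
  with B show "\<exists>B\<in>carrier SL2. B \<otimes>\<^bsub>SL2\<^esub> A = \<one>\<^bsub>SL2\<^esub>" by (auto simp: SL2_def)
qed (auto simp: SL2_def det_mul matrix_mul_assoc)

fun eval_word :: "('a, 'b) monoid_scheme \<Rightarrow> ('g \<Rightarrow> 'a) \<Rightarrow> 'g word \<Rightarrow> 'a" where
  "eval_word H f [] = \<one>\<^bsub>H\<^esub>"
| "eval_word H f ((g, s) # w) = (if s then f g else inv\<^bsub>H\<^esub> f g) \<otimes>\<^bsub>H\<^esub> eval_word H f w"

context group
begin

lemma eval_word_closed [simp]: "range f \<subseteq> carrier G \<Longrightarrow> eval_word G f w \<in> carrier G"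
proof (induction w)
  case (Cons a w)
  then have "f (fst a) \<in> carrier G" by auto
  with Cons show ?case by (cases a) simp
qed simp

lemma eval_word_append:
  assumes "range f \<subseteq> carrier G"
  shows "eval_word G f (u @ v) = eval_word G f u \<otimes> eval_word G f v"
proof (induction u)
  case (Cons a u)
  have "f (fst a) \<in> carrier G" using assms by auto
  with Cons assms show ?case by (cases a) (simp add: m_assoc)
qed (simp add: assms)

lemma eval_word_eq:
  assumes f: "range f \<subseteq> carrier G"
    and Rel: "\<And>u v. (u, v) \<in> Rel \<Longrightarrow> eval_word G f u = eval_word G f v"
    and "word_eq Rel u v"
  shows "eval_word G f u = eval_word G f v"
  using assms(3)
proof (induction rule: word_eq.induct)
  case (cancel g s)
  have "f g \<in> carrier G" using f by auto
  then show ?case by (cases s) auto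
next
  case (rel u v)
  then show ?case by (rule Rel)
qed (simp_all add: eval_word_append[OF f])

lemma eval_power_word:
  assumes f: "range f \<subseteq> carrier G"
  shows "eval_word G f (power_word g k) = f g [^] k"
proof -
  have fg: "f g \<in> carrier G" using f by auto
  have pos: "eval_word G f (replicate j (g, True)) = f g [^] j" for j :: nat
  proof (induction j)
    case (Suc j)
    have "eval_word G f (replicate (Suc j) (g, True)) = f g \<otimes> f g [^] j"
      by (simp only: replicate_Suc eval_word.simps if_True Suc)
    then show ?case unfolding nat_pow_Suc2[OF fg] .
  qed simp
  have neg: "eval_word G f (replicate j (g, False)) = inv (f g [^] j)" for j :: nat
  proof (induction j)
    case (Suc j)
    have "eval_word G f (replicate (Suc j) (g, False)) = inv (f g) \<otimes> inv (f g [^] j)"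
      by (simp only: replicate_Suc eval_word.simps if_False Suc)
    also have "\<dots> = inv (f g [^] Suc j)"
      unfolding nat_pow_Suc using fg by (intro inv_mult_group[symmetric]) auto
    finally show ?case .
  qed simp
  show ?thesis
  proof (cases "k < 0")
    case True
    then have "power_word g k = replicate (nat (- k)) (g, False)" by (simp add: power_word_def)
    with True show ?thesis by (simp only: neg int_pow_def2 if_True)
  next
    case False
    then have "power_word g k = replicate (nat k) (g, True)" by (simp add: power_word_def)
    with False show ?thesis by (simp only: pos int_pow_def2 if_False)
  qed
qed

lemma presented_group_hom_eval:
  assumes "\<rho> \<in> hom (presented_group Rel) G"
  shows "\<rho> (word_class Rel w) = eval_word G (\<lambda>g. \<rho> (word_class Rel [(g, True)])) w"
proof -
  interpret H: group_hom "presented_group Rel" G \<rho>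
    using assms by (simp add: group_hom_def group_hom_axioms_def group_presented_group is_group)
  have inv_gen: "inv\<^bsub>presented_group Rel\<^esub> (word_class Rel [(g, True)]) = word_class Rel [(g, False)]"
    for g
    using word_eq.cancel[of Rel g False]
    by (intro H.G.inv_equality) (auto simp: word_class_eq_iff)
  show ?thesis
  proof (induction w)
    case Nil
    show ?case using H.hom_one by simp
  next
    case (Cons a w)
    obtain g s where a: "a = (g, s)" by (cases a)
    have "\<rho> (word_class Rel (a # w)) = \<rho> (word_class Rel [a]) \<otimes> \<rho> (word_class Rel w)"
      using H.hom_mult[of "word_class Rel [a]" "word_class Rel w"] by simp
    moreover have "\<rho> (word_class Rel [(g, False)]) = inv (\<rho> (word_class Rel [(g, True)]))"
      using H.hom_inv[of "word_class Rel [(g, True)]"] by (simp add: inv_gen)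
    ultimately show ?case using Cons by (cases s) (simp_all add: a)
  qed
qed

lemma presented_group_hom_exists:
  assumes f: "range f \<subseteq> carrier G"
    and Rel: "\<And>u v. (u, v) \<in> Rel \<Longrightarrow> eval_word G f u = eval_word G f v"
  obtains \<rho> where "\<rho> \<in> hom (presented_group Rel) G"
    and "\<And>w. \<rho> (word_class Rel w) = eval_word G f w"
proof
  define \<rho> where "\<rho> U = eval_word G f (SOME u. u \<in> U)" for U
  show eq: "\<rho> (word_class Rel w) = eval_word G f w" for w
  proof -
    have "w \<in> word_class Rel w" by (simp add: word_class_def word_eq.refl)
    then have "(SOME u. u \<in> word_class Rel w) \<in> word_class Rel w" by (rule someI)
    then have "word_eq Rel w (SOME u. u \<in> word_class Rel w)" by (simp add: word_class_def)
    from eval_word_eq[OF f Rel this] show ?thesis by (simp add: \<rho>_def)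
  qed
  show "\<rho> \<in> hom (presented_group Rel) G"
    by (rule homI) (auto simp: eq f eval_word_append)
qed

end

theorem rep_variety_eq:
  "rep_variety m n =
     {(A, B). A \<in> carrier SL2 \<and> B \<in> carrier SL2 \<and> A [^]\<^bsub>SL2\<^esub> m = B [^]\<^bsub>SL2\<^esub> n}"
    (is "_ = ?R")
proof
  interpret SL2: group SL2 by (rule group_SL2)
  show "rep_variety m n \<subseteq> ?R"
  proof (clarsimp simp: rep_variety_def)
    fix \<rho> assume \<rho>: "\<rho> \<in> hom (G_grp m n) SL2"
    let ?f = "\<lambda>g. \<rho> (word_class (relations_G m n) [(g, True)])"
    have f: "range ?f \<subseteq> carrier SL2" using \<rho> by (auto simp: G_grp_def hom_def)
    have "word_class (relations_G m n) (power_word Gen_x m) = word_class (relations_G m n) (power_word Gen_y n)"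
      by (simp add: word_class_eq_iff relations_G_def word_eq.rel)
    then have "eval_word SL2 ?f (power_word Gen_x m) = eval_word SL2 ?f (power_word Gen_y n)"
      unfolding SL2.presented_group_hom_eval[OF \<rho>[unfolded G_grp_def], symmetric] by simp
    then have "?f Gen_x [^]\<^bsub>SL2\<^esub> m = ?f Gen_y [^]\<^bsub>SL2\<^esub> n"
      unfolding SL2.eval_power_word[OF f] .
    with f show "\<rho> (x_G m n) \<in> carrier SL2 \<and> \<rho> (y_G m n) \<in> carrier SL2 \<and>
        \<rho> (x_G m n) [^]\<^bsub>SL2\<^esub> m = \<rho> (y_G m n) [^]\<^bsub>SL2\<^esub> n"
      by (simp add: x_G_def y_G_def image_subset_iff)
  qed
  show "?R \<subseteq> rep_variety m n"
  proof clarify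
    fix A B assume AB: "A \<in> carrier SL2" "B \<in> carrier SL2" "A [^]\<^bsub>SL2\<^esub> m = B [^]\<^bsub>SL2\<^esub> n"
    define f where "f g = (case g of Gen_x \<Rightarrow> A | Gen_y \<Rightarrow> B)" for g
    have f: "range f \<subseteq> carrier SL2" using AB by (auto simp: f_def split: gen.split)
    have Rel: "eval_word SL2 f u = eval_word SL2 f v" if "(u, v) \<in> relations_G m n" for u v
      using that AB(3) by (auto simp: relations_G_def SL2.eval_power_word[OF f] f_def)
    obtain \<rho> where \<rho>: "\<rho> \<in> hom (presented_group (relations_G m n)) SL2"
      "\<And>w. \<rho> (word_class (relations_G m n) w) = eval_word SL2 f w"
      by (rule SL2.presented_group_hom_exists[where Rel = "relations_G m n", OF f]) (erule Rel, rule that)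
    have "\<rho> (x_G m n) = A" "\<rho> (y_G m n) = B"
      using AB by (simp_all add: \<rho>(2) x_G_def y_G_def f_def)
    with \<rho>(1) show "(A, B) \<in> rep_variety m n"
      unfolding rep_variety_def G_grp_def by blast
  qed
qed

end

theory Submission
  imports Defs "HOL-Complex_Analysis.Complex_Analysis"
begin

text \<open>
  A representation is a pair \<open>(A, B)\<close> in \<open>SL(2,\<complex>)\<^sup>2\<close> with \<open>A\<^sup>m = B\<^sup>n\<close>, and this common power commutes
  with both \<open>A\<close> and \<open>B\<close>. If it is not scalar, then \<open>A\<close> and \<open>B\<close> lie in the centralizer of a
  nonscalar two by two matrix, which is commutative. So a noncommuting pair has \<open>A\<^sup>m = B\<^sup>n = e\<close>
  with \<open>e = 1\<close> or \<open>e = -1\<close>. Then \<open>A\<close> and \<open>B\<close> have finite order and are not scalar, hence their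
  eigenvalues \<open>z\<close> and \<open>w\<close> are different from \<open>1\<close> and \<open>-1\<close>, and they satisfy \<open>z\<^sup>m = w\<^sup>n = e\<close>
  (\<open>noncommuting_trace_piece\<close>). Conversely, all pairs in \<open>SL(2,\<complex>)\<^sup>2\<close> with the traces \<open>z + 1/z\<close> and
  \<open>w + 1/w\<close> of such eigenvalues satisfy the relation (\<open>trace_piece_subset\<close>). These trace pieces
  make up the closure of the irreducible locus, because in each of them the pairs with
  \<open>det (A B - B A) \<noteq> 0\<close> form a nonempty open set of irreducible representations (\<open>closure_Irr\<close>).

  For commuting pairs write \<open>m = d p\<close> and \<open>n = d q\<close> with \<open>d = gcd m n\<close>, and choose \<open>x\<close> and \<open>y\<close> with
  \<open>x q + y p = 1\<close>. The substitution \<open>C = A\<^sup>p B\<^sup>-\<^sup>q\<close>, \<open>T = A\<^sup>x B\<^sup>y\<close> has an exponent matrix of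
  determinant one. It is therefore a bijection between commuting pairs, and it turns the
  relation into \<open>C\<^sup>d = 1\<close>. The trace of \<open>C\<close> takes only the finitely many values
  \<open>\<omega> + 1/\<omega>\<close> with \<open>\<omega>\<^sup>d = 1\<close>, so the commuting locus is the disjoint union of the closed sets on
  which this trace is fixed (\<open>Ab_eq_Union\<close>).

  Every piece is irreducible: any two of its points lie on an entire holomorphic curve inside the
  piece, and a product of two entire functions vanishes only if one of them does
  (\<open>irreducible_in_zariskiI\<close>). The curves come from curves in \<open>SL(2,\<complex>)\<close> along products of
  elementary matrices (\<open>SL2_entire_curve\<close>), mostly by conjugation. No piece contains
  another: different pieces of the same kind are disjoint, a trace piece contains noncommuting
  pairs, and the trace of \<open>A\<close> is fixed on a trace piece but not on an abelian piece. Hence the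
  pieces are the irreducible components
  (\<open>irreducible_components_Union\<close>), and it remains to count the values
  \<open>z + 1/z\<close>, where \<open>z\<close> ranges over the roots of \<open>1\<close> or \<open>-1\<close> of a given order. The map
  \<open>z \<mapsto> z + 1/z\<close> is two to one away from \<open>1\<close> and \<open>-1\<close> (\<open>card_half_traces\<close>).
\<close>

section \<open>Complex two by two matrices\<close>

definition mat2 :: "complex \<Rightarrow> complex \<Rightarrow> complex \<Rightarrow> complex \<Rightarrow> complex^2^2" where
  "mat2 a b c d = (\<chi> i j. if i = 1 then if j = 1 then a else b else if j = 1 then c else d)"

lemma mat2_nth [simp]:
  "mat2 a b c d $ 1 $ 1 = a" "mat2 a b c d $ 1 $ 2 = b"
  "mat2 a b c d $ 2 $ 1 = c" "mat2 a b c d $ 2 $ 2 = d"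
  by (simp_all add: mat2_def)

lemma mat2_eq_iff [simp]: "mat2 a b c d = mat2 a' b' c' d' \<longleftrightarrow> a = a' \<and> b = b' \<and> c = c' \<and> d = d'"
  by (auto simp: vec_eq_iff forall_2)

lemma mat2_cases: obtains a b c d where "A = mat2 a b c d"
proof
  show "A = mat2 (A $ 1 $ 1) (A $ 1 $ 2) (A $ 2 $ 1) (A $ 2 $ 2)"
    by (simp add: vec_eq_iff forall_2)
qed

lemma mat2_mult:
  "mat2 a b c d ** mat2 a' b' c' d' =
     mat2 (a * a' + b * c') (a * b' + b * d') (c * a' + d * c') (c * b' + d * d')"
  by (simp add: vec_eq_iff forall_2 matrix_matrix_mult_def sum_2)

lemma mat2_diff: "mat2 a b c d - mat2 a' b' c' d' = mat2 (a - a') (b - b') (c - c') (d - d')"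
  by (simp add: vec_eq_iff forall_2)

lemma det_mat2: "det (mat2 a b c d) = a * d - b * c"
  by (simp add: det_2)

lemma trace_mat2: "trace (mat2 a b c d) = a + d"
  by (simp add: trace_def sum_2)

lemma mat_eq_mat2: "mat k = mat2 k 0 0 k"
  by (simp add: vec_eq_iff forall_2 mat_def)

definition vec2 :: "complex \<Rightarrow> complex \<Rightarrow> complex^2" where
  "vec2 x y = (\<chi> i. if i = 1 then x else y)"

lemma vec2_nth [simp]: "vec2 x y $ 1 = x" "vec2 x y $ 2 = y"
  by (simp_all add: vec2_def)

lemma vec2_eq_iff [simp]: "vec2 x y = vec2 x' y' \<longleftrightarrow> x = x' \<and> y = y'"
  by (auto simp: vec_eq_iff forall_2)

lemma vec2_cases: obtains x y where "v = vec2 x y"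
proof
  show "v = vec2 (v $ 1) (v $ 2)" by (simp add: vec_eq_iff forall_2)
qed

lemma zero_vec2: "0 = vec2 0 0"
  by (simp add: vec_eq_iff forall_2)

lemma mat2_mult_vec2: "mat2 a b c d *v vec2 x y = vec2 (a * x + b * y) (c * x + d * y)"
  by (simp add: vec_eq_iff forall_2 matrix_vector_mult_def sum_2)

lemma smult_vec2: "k *s vec2 x y = vec2 (k * x) (k * y)"
  by (simp add: vec_eq_iff forall_2)

lemmas mat2_simps = mat2_mult mat2_diff det_mat2 trace_mat2 mat_eq_mat2 zero_vec2
  mat2_mult_vec2 smult_vec2

definition adjugate2 :: "complex^2^2 \<Rightarrow> complex^2^2" where
  "adjugate2 A = mat2 (A $ 2 $ 2) (- A $ 1 $ 2) (- A $ 2 $ 1) (A $ 1 $ 1)"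

definition diag2 :: "complex \<Rightarrow> complex^2^2" where
  "diag2 u = mat2 u 0 0 (inverse u)"

interpretation SL2: group SL2 by (rule group_SL2)

lemma carrier_SL2 [simp]: "A \<in> carrier SL2 \<longleftrightarrow> det A = 1"
  by (simp add: SL2_def)

lemma mult_SL2 [simp]: "A \<otimes>\<^bsub>SL2\<^esub> B = A ** B"
  by (simp add: SL2_def)

lemma one_SL2 [simp]: "\<one>\<^bsub>SL2\<^esub> = mat 1"
  by (simp add: SL2_def)

lemma adjugate2_mat2: "adjugate2 (mat2 a b c d) = mat2 d (- b) (- c) a"
  by (simp add: adjugate2_def)

lemma inv_SL2: "det A = 1 \<Longrightarrow> inv\<^bsub>SL2\<^esub> A = adjugate2 A"
  by (cases A rule: mat2_cases, rule SL2.inv_equality) (simp_all add: adjugate2_mat2 mat2_simps algebra_simps)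

lemma det_adjugate2 [simp]: "det (adjugate2 A) = det A"
  by (cases A rule: mat2_cases) (simp add: adjugate2_mat2 mat2_simps)

lemma adjugate2_mult:
  assumes "det A = 1"
  shows "A ** adjugate2 A = mat 1" "adjugate2 A ** A = mat 1"
  using SL2.r_inv[of A] SL2.l_inv[of A] assms by (simp_all add: inv_SL2)

lemma det_diag2 [simp]: "u \<noteq> 0 \<Longrightarrow> det (diag2 u) = 1"
  by (simp add: diag2_def mat2_simps)

lemma diag2_mult: "diag2 u ** diag2 v = diag2 (u * v)"
  by (simp add: diag2_def mat2_simps)

lemma diag2_nat_pow: "diag2 u [^]\<^bsub>SL2\<^esub> (k :: nat) = diag2 (u ^ k)"
  by (induction k) (simp_all add: diag2_mult mult.commute, simp add: diag2_def mat2_simps)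

lemma diag2_int_pow: "u \<noteq> 0 \<Longrightarrow> diag2 u [^]\<^bsub>SL2\<^esub> (k :: int) = diag2 (u powi k)"
  by (simp add: int_pow_def2 diag2_nat_pow power_int_def inv_SL2)
     (simp add: diag2_def adjugate2_mat2 power_inverse)

text \<open>Conjugation uses the adjugate instead of the inverse, so that it is polynomial in the
  entries of \<open>g\<close>.\<close>

definition conjugate :: "complex^2^2 \<Rightarrow> complex^2^2 \<Rightarrow> complex^2^2" where
  "conjugate g A = g ** A ** adjugate2 g"

lemma conjugate_mult:
  assumes "det g = 1"
  shows "conjugate g A ** conjugate g B = conjugate g (A ** B)"
proof -
  have "conjugate g A ** conjugate g B = g ** A ** (adjugate2 g ** g) ** B ** adjugate2 g"
    by (simp add: conjugate_def matrix_mul_assoc)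
  then show ?thesis by (simp add: conjugate_def adjugate2_mult[OF assms] matrix_mul_assoc)
qed

lemma conjugate_one: "det g = 1 \<Longrightarrow> conjugate g (mat 1) = mat 1"
  by (simp add: conjugate_def adjugate2_mult)

lemma det_conjugate: "det g = 1 \<Longrightarrow> det (conjugate g A) = det A"
  by (simp add: conjugate_def det_mul)

lemma trace_conjugate:
  assumes "det g = 1"
  shows "trace (conjugate g A) = trace A"
proof -
  have "trace (conjugate g A) = trace (adjugate2 g ** (g ** A))"
    unfolding conjugate_def by (rule trace_mul_sym)
  then show ?thesis by (simp add: matrix_mul_assoc adjugate2_mult[OF assms])
qed

lemma conjugate_cancel:
  assumes "det g = 1"
  shows "conjugate g (conjugate (adjugate2 g) A) = A"
proof -
  have "adjugate2 (adjugate2 g) = g" by (cases g rule: mat2_cases) (simp add: adjugate2_mat2)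
  then have "conjugate g (conjugate (adjugate2 g) A) = (g ** adjugate2 g) ** A ** (g ** adjugate2 g)"
    by (simp add: conjugate_def matrix_mul_assoc)
  then show ?thesis by (simp add: adjugate2_mult[OF assms])
qed

lemma conjugate_inj:
  assumes "det g = 1"
  shows "conjugate g A = conjugate g B \<longleftrightarrow> A = B"
proof -
  have "adjugate2 g ** conjugate g X ** g = X" for X
  proof -
    have "adjugate2 g ** conjugate g X ** g = (adjugate2 g ** g) ** X ** (adjugate2 g ** g)"
      by (simp add: conjugate_def matrix_mul_assoc)
    then show ?thesis by (simp add: adjugate2_mult[OF assms])
  qed
  then show ?thesis by metis
qed

lemma conjugate_nat_pow:
  "det g = 1 \<Longrightarrow> conjugate g A [^]\<^bsub>SL2\<^esub> (k :: nat) = conjugate g (A [^]\<^bsub>SL2\<^esub> k)"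
  by (induction k) (simp_all add: conjugate_one conjugate_mult)

section \<open>Eigenvalues and commuting matrices\<close>

text \<open>The commutation equations say that the vector \<open>(x - w, y, z)\<close> formed from the entries of a
  matrix is a multiple of the corresponding nonzero vector of \<open>A\<close>. So any two matrices in the
  centralizer of \<open>A\<close> have parallel vectors.\<close>

lemma centralizer_of_nonscalar_commutative:
  fixes A X Y :: "complex^2^2"
  assumes nonscalar: "\<And>k. A \<noteq> mat k"
    and X: "X ** A = A ** X" and Y: "Y ** A = A ** Y"
  shows "X ** Y = Y ** X"
proof -
  obtain a b c d where A: "A = mat2 a b c d" by (rule mat2_cases)
  obtain x y z w where x: "X = mat2 x y z w" by (rule mat2_cases)
  obtain x' y' z' w' where y: "Y = mat2 x' y' z' w'" by (rule mat2_cases)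
  have ns: "a \<noteq> d \<or> b \<noteq> 0 \<or> c \<noteq> 0" using nonscalar[of a] by (auto simp: A mat2_simps)
  have X': "y * c = b * z" "(x - w) * b = (a - d) * y" "(x - w) * c = (a - d) * z"
    using X by (simp_all add: A x mat2_simps) algebra+
  have Y': "y' * c = b * z'" "(x' - w') * b = (a - d) * y'" "(x' - w') * c = (a - d) * z'"
    using Y by (simp_all add: A y mat2_simps) algebra+
  from ns have "y * z' = y' * z \<and> (x - w) * y' = (x' - w') * y \<and> (x - w) * z' = (x' - w') * z"
  proof (elim disjE)
    assume "a \<noteq> d"
    then have nz: "a - d \<noteq> 0" by simp
    have "(a - d) * (y * z') = (a - d) * (y' * z)" "(a - d) * ((x - w) * y') = (a - d) * ((x' - w') * y)"
      "(a - d) * ((x - w) * z') = (a - d) * ((x' - w') * z)" using X' Y' by algebra+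
    with nz show ?thesis by (metis mult_left_cancel)
  next
    assume nz: "b \<noteq> 0"
    have "b * (y * z') = b * (y' * z)" "b * ((x - w) * y') = b * ((x' - w') * y)"
      "b * ((x - w) * z') = b * ((x' - w') * z)" using X' Y' by algebra+
    with nz show ?thesis by (metis mult_left_cancel)
  next
    assume nz: "c \<noteq> 0"
    have "c * (y * z') = c * (y' * z)" "c * ((x - w) * y') = c * ((x' - w') * y)"
      "c * ((x - w) * z') = c * ((x' - w') * z)" using X' Y' by algebra+
    with nz show ?thesis by (metis mult_left_cancel)
  qed
  then show ?thesis by (simp add: x y mat2_simps algebra_simps)
qed

text \<open>A matrix of determinant one and trace \<open>t\<close> has the eigenvalues \<open>z\<close> and \<open>1/z\<close>, where \<open>z\<close> is a
  root of \<open>z\<^sup>2 - t z + 1\<close>. The eigenvalue \<open>z\<close> is used throughout as the parameter for the trace.\<close>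

lemma exists_reciprocal_sum: "\<exists>z::complex. z \<noteq> 0 \<and> z + inverse z = t"
proof
  define r where "r = csqrt (t\<^sup>2 - 4)"
  define z where "z = (t + r) / 2"
  have r: "r * r = t * t - 4" unfolding r_def using power2_csqrt by (simp add: power2_eq_square)
  have "2 * z = t + r" by (simp add: z_def)
  with r have "4 * (z * z + 1 - t * z) = 0" by algebra
  then have "z * z + 1 - t * z = 0" by (simp only: mult_eq_0_iff) simp
  then have eq: "z * z + 1 = t * z" by simp
  then have "z \<noteq> 0" by auto
  moreover from this eq have "z + inverse z = t" by (simp add: field_simps)
  ultimately show "z \<noteq> 0 \<and> z + inverse z = t" ..
qed

lemma reciprocal_sum_eq_iff:
  fixes z w :: complex
  assumes "z \<noteq> 0" "w \<noteq> 0"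
  shows "z + inverse z = w + inverse w \<longleftrightarrow> z = w \<or> z = inverse w"
proof -
  have "z + inverse z - (w + inverse w) = (z - w) * (z * w - 1) / (z * w)"
    using assms by (simp add: field_simps)
  then have "z + inverse z = w + inverse w \<longleftrightarrow> z = w \<or> z * w = 1"
    using assms by (metis divide_eq_0_iff eq_iff_diff_eq_0 mult_eq_0_iff)
  also have "z * w = 1 \<longleftrightarrow> z = inverse w" using assms by (simp add: field_simps)
  finally show ?thesis .
qed

lemma eigenvector_exists:
  fixes A :: "complex^2^2"
  assumes "det A = 1" and tr: "trace A = z + inverse z" and z: "z \<noteq> 0"
  obtains v where "v \<noteq> 0" "A *v v = z *s v"
proof -
  obtain a b c d where A: "A = mat2 a b c d" by (rule mat2_cases)
  have det: "a * d - b * c = 1" using assms by (simp add: A mat2_simps)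
  have "z * (a + d) = z * z + 1" using tr z by (simp add: A mat2_simps field_simps)
  \<comment> \<open>the characteristic equation\<close>
  then have ch: "(a - z) * (d - z) = b * c" using det by algebra
  show ?thesis
  proof (cases "b = 0 \<and> a = z")
    case True
    show ?thesis
    proof (cases "c = 0 \<and> d = z")
      case True' : True
      with True show ?thesis
        by (intro that[of "vec2 1 0"]) (auto simp: A mat2_simps)
    next
      case False
      with True show ?thesis
        by (intro that[of "vec2 (z - d) c"]) (auto simp: A mat2_simps algebra_simps)
    qed
  next
    case False
    have "a * (- b) + b * (a - z) = z * (- b)" by (simp add: algebra_simps)
    moreover have "c * (- b) + d * (a - z) = z * (a - z)" using ch by algebra
    ultimately have "A *v vec2 (- b) (a - z) = z *s vec2 (- b) (a - z)"
      by (simp only: A mat2_simps)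
    with False show ?thesis by (intro that[of "vec2 (- b) (a - z)"]) (auto simp: mat2_simps)
  qed
qed

text \<open>The eigenvalues \<open>z\<close> and \<open>1/z\<close> are different, so eigenvectors for them are independent. Dividing
  one of the two by the determinant of the basis puts the conjugating matrix into
  \<open>SL(2,\<complex>)\<close>.\<close>

lemma diagonalize:
  fixes A :: "complex^2^2"
  assumes det: "det A = 1" and tr: "trace A = z + inverse z" and z: "z \<noteq> 0" "z\<^sup>2 \<noteq> 1"
  obtains g where "det g = 1" "A = conjugate g (diag2 z)"
proof -
  obtain a b c d where A: "A = mat2 a b c d" by (rule mat2_cases)
  obtain v where v: "v \<noteq> 0" "A *v v = z *s v" using eigenvector_exists[OF det tr z(1)] .
  obtain w where w: "w \<noteq> 0" "A *v w = inverse z *s w"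
    using eigenvector_exists[of A "inverse z"] det tr z by (auto simp: add.commute)
  obtain v1 v2 where v': "v = vec2 v1 v2" by (rule vec2_cases)
  obtain w1 w2 where w': "w = vec2 w1 w2" by (rule vec2_cases)
  define D where "D = v1 * w2 - v2 * w1"
  have ev: "a * v1 + b * v2 = z * v1" "c * v1 + d * v2 = z * v2"
    "a * w1 + b * w2 = inverse z * w1" "c * w1 + d * w2 = inverse z * w2"
    using v w by (simp_all add: A v' w' mat2_simps)
  have nz: "z - inverse z \<noteq> 0" using z by (auto simp: field_simps power2_eq_square)
  have "D \<noteq> 0"
  proof
    assume "D = 0"
    then have D: "v1 * w2 = v2 * w1" by (simp add: D_def)
    have "(z - inverse z) * (v1 * w1) = 0" "(z - inverse z) * (v2 * w2) = 0"
      "(z - inverse z) * (v1 * w2) = 0"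
      using ev D by algebra+
    with nz v w D show False by (auto simp: v' w' mat2_simps)
  qed
  let ?g = "mat2 v1 (w1 / D) v2 (w2 / D)"
  have "det ?g = (v1 * w2 - v2 * w1) / D" by (simp add: mat2_simps diff_divide_distrib)
  then have g: "det ?g = 1" using \<open>D \<noteq> 0\<close> by (simp add: D_def)
  have "A ** ?g = ?g ** diag2 z"
    using ev \<open>D \<noteq> 0\<close> by (simp add: A diag2_def mat2_simps field_simps)
  then have "conjugate ?g (diag2 z) = A ** (?g ** adjugate2 ?g)"
    by (simp add: conjugate_def matrix_mul_assoc)
  then show ?thesis using g by (intro that[of ?g]) (simp_all add: adjugate2_mult)
qed

lemma commutes_with_diag2:
  assumes "T ** diag2 z = diag2 z ** T" "det T = 1" "z \<noteq> 0" "z\<^sup>2 \<noteq> 1"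
  obtains u where "u \<noteq> 0" "T = diag2 u"
proof -
  obtain a b c d where T: "T = mat2 a b c d" by (rule mat2_cases)
  have nz: "z - inverse z \<noteq> 0" using assms(3,4) by (auto simp: field_simps power2_eq_square)
  have "b * inverse z = z * b" "c * z = inverse z * c"
    using assms(1) by (simp_all only: T diag2_def mat2_simps mat2_eq_iff) simp_all
  then have "b * (z - inverse z) = 0" "c * (z - inverse z) = 0" by algebra+
  with nz have "b = 0" "c = 0" by auto
  moreover from this have "a * d = 1" using assms(2) by (simp add: T mat2_simps)
  ultimately show ?thesis
    by (intro that[of a]) (auto simp: T diag2_def inverse_unique[symmetric])
qed

text \<open>The scalar \<open>e\<close> is equal to the eigenvalue \<open>z\<^sup>k\<close> of \<open>A\<^sup>k\<close>. If \<open>z\<^sup>2 = 1\<close>, then \<open>z\<close> is a double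
  eigenvalue of \<open>A\<close>, that is, \<open>A = z + N\<close> with \<open>N\<^sup>2 = 0\<close>. Then
  \<open>A\<^sup>k = z\<^sup>k + k z\<^sup>k\<^sup>-\<^sup>1 N\<close>. This is scalar only if \<open>N = 0\<close>.\<close>

lemma scalar_power_cases:
  fixes A :: "complex^2^2" and k :: nat
  assumes det: "det A = 1" and pow: "A [^]\<^bsub>SL2\<^esub> k = mat e" and k: "k > 0"
    and tr: "trace A = z + inverse z" and z: "z \<noteq> 0"
  shows "z ^ k = e" and "z\<^sup>2 = 1 \<Longrightarrow> A = mat z"
proof -
  obtain v where v: "v \<noteq> 0" "A *v v = z *s v" using eigenvector_exists[OF det tr z] .
  have "(A [^]\<^bsub>SL2\<^esub> j) *v v = (z ^ j) *s v" for j :: nat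
  proof (induction j)
    case (Suc j)
    have "(A [^]\<^bsub>SL2\<^esub> Suc j) *v v = (A [^]\<^bsub>SL2\<^esub> j) *v (z *s v)"
      by (simp add: matrix_vector_mul_assoc[symmetric] v)
    also have "\<dots> = z *s ((A [^]\<^bsub>SL2\<^esub> j) *v v)" by (simp add: vector_scalar_commute)
    finally show ?case by (simp add: Suc)
  qed simp
  with pow have "mat e *v v = (z ^ k) *s v" by metis
  then show "z ^ k = e" using v(1) by (cases v rule: vec2_cases) (auto simp: mat2_simps)
  assume z2: "z\<^sup>2 = 1"
  then have iz: "inverse z = z" using z by (simp add: field_simps power2_eq_square)
  obtain a b c d where A: "A = mat2 a b c d" by (rule mat2_cases)
  have t: "a + d = 2 * z" using tr iz by (simp add: A mat2_simps)
  have D: "a * d - b * c = 1" using det by (simp add: A mat2_simps)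
  have z2': "z * z = 1" using z2 by (simp add: power2_eq_square)
  have N: "(a - z) * (a - z) + b * c = 0" "(d - z) * (d - z) + b * c = 0"
    "b * (a - z) + b * (d - z) = 0" "c * (a - z) + c * (d - z) = 0"
    using t D z2' by algebra+
  \<comment> \<open>This is \<open>j z\<^sup>j\<^sup>-\<^sup>1\<close>, written without a truncated exponent by using \<open>z\<^sup>2 = 1\<close>.\<close>
  define p where "p j = of_nat j * z ^ (j + 1)" for j :: nat
  have p: "p (Suc j) = p j * z + z ^ j" for j
    using z2' by (simp add: p_def algebra_simps)
  have "A [^]\<^bsub>SL2\<^esub> j = mat2 (z ^ j + p j * (a - z)) (p j * b) (p j * c) (z ^ j + p j * (d - z))" for j
  proof (induction j)
    case 0
    show ?case by (simp add: p_def mat2_simps)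
  next
    case (Suc j)
    show ?case unfolding nat_pow_Suc Suc p
      using N by (simp add: A mat2_simps) algebra
  qed
  from this[of k] have
    "mat2 (z ^ k + p k * (a - z)) (p k * b) (p k * c) (z ^ k + p k * (d - z)) = mat2 e 0 0 e"
    unfolding pow mat_eq_mat2 by metis
  then have pk: "p k * b = 0" "p k * c = 0"
    "z ^ k + p k * (a - z) = e" "z ^ k + p k * (d - z) = e"
    unfolding mat2_eq_iff by blast+
  have "p k * (a - z) = p k * (d - z)" using pk(3,4) by (metis add_left_cancel)
  then have "p k * (a - d) = 0" by (simp add: algebra_simps)
  moreover have "p k \<noteq> 0" using k z by (simp add: p_def)
  ultimately have "b = 0" "c = 0" "a = d" using pk(1,2) by simp_all
  with t show "A = mat z" by (simp add: A mat2_simps)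
qed

lemma parallel_of_annihilated:
  fixes p q v1 v2 u1 u2 :: complex
  assumes "p \<noteq> 0 \<or> q \<noteq> 0" "p * v1 + q * v2 = 0" "p * u1 + q * u2 = 0" "v1 \<noteq> 0 \<or> v2 \<noteq> 0"
  shows "\<exists>k. u1 = k * v1 \<and> u2 = k * v2"
proof -
  have "p * (u1 * v2 - u2 * v1) = 0" "q * (u1 * v2 - u2 * v1) = 0" using assms(2,3) by algebra+
  with assms(1) have eq: "u1 * v2 = u2 * v1" by auto
  show ?thesis
  proof (cases "v1 = 0")
    case True
    with eq assms(4) show ?thesis by (intro exI[of _ "u2 / v2"]) auto
  next
    case False
    with eq show ?thesis by (intro exI[of _ "u1 / v1"]) (auto simp: field_simps)
  qed
qed

text \<open>An eigenspace of a nonscalar two by two matrix is a line, and it is preserved by every matrix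
  that commutes with it.\<close>

lemma commuting_common_eigenvector:
  fixes A B :: "complex^2^2"
  assumes comm: "A ** B = B ** A" and det: "det A = 1" "det B = 1"
  obtains v a b where "v \<noteq> 0" "A *v v = a *s v" "B *v v = b *s v"
proof (cases "\<exists>k. A = mat k")
  case True
  then obtain k where k: "A = mat k" ..
  obtain z where z: "z \<noteq> 0" "z + inverse z = trace B" using exists_reciprocal_sum by blast
  obtain v where v: "v \<noteq> 0" "B *v v = z *s v" using eigenvector_exists[of B z] det z by metis
  have "A *v v = k *s v" by (cases v rule: vec2_cases) (simp add: k mat2_simps)
  with v that show ?thesis by blast
next
  case False
  obtain z where z: "z \<noteq> 0" "z + inverse z = trace A" using exists_reciprocal_sum by blast
  obtain v where v: "v \<noteq> 0" "A *v v = z *s v" using eigenvector_exists[of A z] det z by metis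
  obtain a b c d where A: "A = mat2 a b c d" by (rule mat2_cases)
  obtain v1 v2 where v': "v = vec2 v1 v2" by (rule vec2_cases)
  obtain u1 u2 where u': "B *v v = vec2 u1 u2" by (rule vec2_cases)
  have "A *v (B *v v) = B *v (z *s v)"
    by (metis comm matrix_vector_mul_assoc v(2))
  also have "\<dots> = z *s (B *v v)" by (simp add: vector_scalar_commute)
  finally have u: "A *v (B *v v) = z *s (B *v v)" .
  have ev: "(a - z) * v1 + b * v2 = 0" "c * v1 + (d - z) * v2 = 0"
    "(a - z) * u1 + b * u2 = 0" "c * u1 + (d - z) * u2 = 0"
    using v(2) u unfolding u' by (simp_all add: A v' mat2_simps algebra_simps)
  have nz: "v1 \<noteq> 0 \<or> v2 \<noteq> 0" using v(1) by (auto simp: v' zero_vec2)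
  have "\<exists>k. u1 = k * v1 \<and> u2 = k * v2"
  proof (cases "a = z \<and> b = 0")
    case True
    have "A \<noteq> mat z" using False by blast
    with True have "c \<noteq> 0 \<or> d - z \<noteq> 0" by (auto simp: A mat2_simps)
    from parallel_of_annihilated[OF this ev(2,4) nz] show ?thesis .
  next
    case False
    then have "a - z \<noteq> 0 \<or> b \<noteq> 0" by auto
    from parallel_of_annihilated[OF this ev(1,3) nz] show ?thesis .
  qed
  then obtain k where "B *v v = k *s v" unfolding u' by (auto simp: v' mat2_simps)
  with v that show ?thesis by blast
qed

section \<open>Matrices with entries in an algebra of functions\<close>

text \<open>The same closure properties are used twice: for polynomial functions on pairs of matrices,
  where they show that sets are Zariski closed, and for entire functions, where they show that
  curves of matrices are holomorphic.\<close>

locale function_algebra =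
  fixes F :: "('x \<Rightarrow> complex) set"
  assumes const: "(\<lambda>_. c) \<in> F"
    and add: "f \<in> F \<Longrightarrow> g \<in> F \<Longrightarrow> (\<lambda>x. f x + g x) \<in> F"
    and mult: "f \<in> F \<Longrightarrow> g \<in> F \<Longrightarrow> (\<lambda>x. f x * g x) \<in> F"
begin

definition entries_in :: "('x \<Rightarrow> complex^2^2) \<Rightarrow> bool" where
  "entries_in M \<longleftrightarrow> (\<forall>i j. (\<lambda>x. M x $ i $ j) \<in> F)"

lemma entries_inD: "entries_in M \<Longrightarrow> (\<lambda>x. M x $ i $ j) \<in> F"
  by (simp add: entries_in_def)

lemma uminus: "f \<in> F \<Longrightarrow> (\<lambda>x. - f x) \<in> F"
  using mult[OF const[of "- 1"], of f] by simp

lemma diff: "f \<in> F \<Longrightarrow> g \<in> F \<Longrightarrow> (\<lambda>x. f x - g x) \<in> F"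
  using add[OF _ uminus, of f g] by simp

lemma entries_in_const: "entries_in (\<lambda>_. A)"
  by (simp add: entries_in_def const)

lemma entries_in_mat2:
  "a \<in> F \<Longrightarrow> b \<in> F \<Longrightarrow> c \<in> F \<Longrightarrow> d \<in> F \<Longrightarrow> entries_in (\<lambda>x. mat2 (a x) (b x) (c x) (d x))"
  by (simp add: entries_in_def forall_2)

lemma entries_in_mult:
  assumes "entries_in M" "entries_in N"
  shows "entries_in (\<lambda>x. M x ** N x)"
  unfolding entries_in_def matrix_matrix_mult_def
  by (simp add: sum_2 add mult entries_inD assms)

lemma entries_in_diff:
  assumes "entries_in M" "entries_in N"
  shows "entries_in (\<lambda>x. M x - N x)"
  unfolding entries_in_def by (simp add: diff entries_inD assms)

lemma entries_in_adjugate2: "entries_in M \<Longrightarrow> entries_in (\<lambda>x. adjugate2 (M x))"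
  unfolding adjugate2_def by (intro entries_in_mat2 uminus entries_inD)

lemma entries_in_conjugate:
  "entries_in g \<Longrightarrow> entries_in M \<Longrightarrow> entries_in (\<lambda>x. conjugate (g x) (M x))"
  unfolding conjugate_def by (intro entries_in_mult entries_in_adjugate2)

lemma entries_in_nat_pow: "entries_in M \<Longrightarrow> entries_in (\<lambda>x. M x [^]\<^bsub>SL2\<^esub> (k :: nat))"
  by (induction k) (simp_all add: entries_in_const entries_in_mult)

lemma det_in: "entries_in M \<Longrightarrow> (\<lambda>x. det (M x)) \<in> F"
  unfolding det_2 by (intro diff mult entries_inD)

lemma trace_in: "entries_in M \<Longrightarrow> (\<lambda>x. trace (M x)) \<in> F"
  unfolding trace_def sum_2 by (intro add entries_inD)

end

text \<open>Negative powers in the group \<open>SL2\<close> involve the group inverse, which has no meaning outside the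
  group. This extension to all matrices is polynomial in the entries.\<close>

definition adjugate_power :: "complex^2^2 \<Rightarrow> int \<Rightarrow> complex^2^2" where
  "adjugate_power A k =
     (if k < 0 then adjugate2 (A [^]\<^bsub>SL2\<^esub> nat (- k)) else A [^]\<^bsub>SL2\<^esub> nat k)"

lemma adjugate_power_eq: "det A = 1 \<Longrightarrow> adjugate_power A k = A [^]\<^bsub>SL2\<^esub> k"
proof -
  have "det (A [^]\<^bsub>SL2\<^esub> (j :: nat)) = 1" if "det A = 1" for j
    using SL2.nat_pow_closed[of A j] that by simp
  then show "det A = 1 \<Longrightarrow> adjugate_power A k = A [^]\<^bsub>SL2\<^esub> k"
    unfolding adjugate_power_def int_pow_def2 by (simp only: inv_SL2)
qed

lemma (in function_algebra) entries_in_adjugate_power: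
  "entries_in M \<Longrightarrow> entries_in (\<lambda>x. adjugate_power (M x) k)"
  unfolding adjugate_power_def
  by (cases "k < 0") (simp_all only: if_True if_False entries_in_nat_pow entries_in_adjugate2)

lemma (in function_algebra) entries_in_int_pow:
  assumes "entries_in M" "\<And>x. det (M x) = 1"
  shows "entries_in (\<lambda>x. M x [^]\<^bsub>SL2\<^esub> (k :: int))"
  using entries_in_adjugate_power[OF assms(1), of k] by (simp add: adjugate_power_eq assms(2))

interpretation poly: function_algebra polynomial_functions
  by unfold_locales (auto intro: polynomial_functions.intros)

interpretation entire: function_algebra "{f. f holomorphic_on UNIV}"
  by unfold_locales (auto intro: holomorphic_intros)

lemma poly_entries_fst: "poly.entries_in fst" and poly_entries_snd: "poly.entries_in snd"
  by (auto simp: poly.entries_in_def intro: polynomial_functions.intros)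

section \<open>Irreducibility from entire curves\<close>

text \<open>The identity theorem: if the first factor does not vanish at \<open>0\<close>, then the second one vanishes
  on a neighbourhood of \<open>0\<close>.\<close>

lemma entire_product_zero:
  assumes f: "f holomorphic_on UNIV" and g: "g holomorphic_on UNIV"
    and fg: "\<And>t. f t * g t = (0::complex)" and f0: "f 0 \<noteq> 0"
  shows "g w = 0"
proof -
  have "continuous (at 0) f"
    using f by (metis holomorphic_on_imp_continuous_on continuous_on_eq_continuous_at open_UNIV UNIV_I)
  from continuous_at_avoid[OF this f0] obtain e
    where e: "e > 0" "\<And>y. dist 0 y < e \<Longrightarrow> f y \<noteq> 0" by blast
  show ?thesis
  proof (rule analytic_continuation[OF g open_UNIV connected_UNIV subset_UNIV UNIV_I])
    show "(0::complex) islimpt ball 0 e" using e(1) by (simp add: islimpt_ball)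
    show "g z = 0" if "z \<in> ball 0 e" for z
      using fg[of z] e(2)[of z] that by simp
  qed simp
qed

lemma polynomial_along_curve:
  assumes "f \<in> polynomial_functions" "entire.entries_in A" "entire.entries_in B"
  shows "(\<lambda>t. f (A t, B t)) holomorphic_on UNIV"
  using assms(1)
proof induction
  case (coord_fst i j)
  then show ?case using entire.entries_inD[OF assms(2)] by simp
next
  case (coord_snd i j)
  then show ?case using entire.entries_inD[OF assms(3)] by simp
qed (auto intro: holomorphic_intros)

text \<open>If \<open>S\<close> is covered by two closed sets and contained in neither, there are polynomials \<open>f\<close> and
  \<open>g\<close>, one among the equations of each closed set, that do not vanish at some points \<open>P\<close> and \<open>Q\<close> of \<open>S\<close>.
  Along a curve in \<open>S\<close> through \<open>P\<close> and \<open>Q\<close> the product of \<open>f\<close> and \<open>g\<close> is zero, but neither factor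
  is.\<close>

lemma irreducible_in_zariskiI:
  assumes ne: "S \<noteq> {}"
    and curve: "\<And>A0 B0 A1 B1. (A0, B0) \<in> S \<Longrightarrow> (A1, B1) \<in> S \<Longrightarrow>
      \<exists>A B. entire.entries_in A \<and> entire.entries_in B \<and> A 0 = A0 \<and> B 0 = B0 \<and>
        A 1 = A1 \<and> B 1 = B1 \<and> (\<forall>t. (A t, B t) \<in> S)"
  shows "irreducible_in zariski S"
  unfolding irreducible_in_def
proof (intro conjI allI impI ne)
  fix C D assume CD: "closedin zariski C \<and> closedin zariski D \<and> S \<subseteq> C \<union> D"
  then obtain F G where F: "F \<subseteq> polynomial_functions" "C = zero_locus F"
    and G: "G \<subseteq> polynomial_functions" "D = zero_locus G"
    by (auto simp: closedin_zariski_iff)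
  show "S \<subseteq> C \<or> S \<subseteq> D"
  proof (rule ccontr)
    assume "\<not> (S \<subseteq> C \<or> S \<subseteq> D)"
    then obtain A0 B0 A1 B1 where P: "(A0, B0) \<in> S" "(A0, B0) \<notin> C" "(A1, B1) \<in> S" "(A1, B1) \<notin> D"
      by auto
    then obtain f g where f: "f \<in> F" "f (A0, B0) \<noteq> 0" and g: "g \<in> G" "g (A1, B1) \<noteq> 0"
      by (auto simp: F G zero_locus_def)
    obtain A B where AB: "entire.entries_in A" "entire.entries_in B" "A 0 = A0" "B 0 = B0"
      "A 1 = A1" "B 1 = B1" "\<And>t. (A t, B t) \<in> S" using curve[OF P(1,3)] by blast
    have "f (A t, B t) * g (A t, B t) = 0" for t
    proof -
      have "(A t, B t) \<in> C \<union> D" using CD AB(7) by blast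
      then show ?thesis using f(1) g(1) by (auto simp: F G zero_locus_def)
    qed
    moreover have "(\<lambda>t. f (A t, B t)) holomorphic_on UNIV" "(\<lambda>t. g (A t, B t)) holomorphic_on UNIV"
      using F(1) G(1) f(1) g(1) AB(1,2) by (auto intro: polynomial_along_curve)
    ultimately have "g (A 1, B 1) = 0"
      using entire_product_zero[of "\<lambda>t. f (A t, B t)" "\<lambda>t. g (A t, B t)" 1] f(2) AB(3,4) by simp
    with g(2) AB(5,6) show False by simp
  qed
qed simp

text \<open>A matrix whose lower left entry \<open>y\<close> is not zero is a product of three elementary matrices, the
  middle one with the entry \<open>y\<close>. The fourth factor is there to make this entry nonzero.\<close>

lemma elementary_factorization:
  assumes "det g = 1"
  obtains x y z w where
    "g = mat2 1 x 0 1 ** mat2 1 0 y 1 ** mat2 1 z 0 1 ** mat2 1 0 w 1"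
proof -
  obtain a b c d where g: "g = mat2 a b c d" by (rule mat2_cases)
  have det: "a * d - b * c = 1" using assms by (simp add: g mat2_simps)
  define w where "w = (if c = 0 then - 1 else 0 :: complex)"
  define y where "y = c - d * w"
  have y: "y \<noteq> 0" using det by (auto simp: y_def w_def)
  define x where "x = (a - b * w - 1) / y"
  define z where "z = (d - 1) / y"
  have xz: "x * y = a - b * w - 1" "z * y = d - 1" using y by (simp_all add: x_def z_def)
  have c: "y + d * w = c" by (simp add: y_def)
  have "y * ((1 + x * y) * z + x) = y * b" using xz c det by algebra
  with y have "(1 + x * y) * z + x = b" by simp
  moreover have "1 + x * y + b * w = a" "y * z + 1 = d" using xz by algebra+
  ultimately have "g = mat2 1 x 0 1 ** mat2 1 0 y 1 ** mat2 1 z 0 1 ** mat2 1 0 w 1"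
    using c by (simp add: g mat2_simps)
  then show ?thesis by (rule that)
qed

text \<open>Scaling the parameters of the elementary factors by \<open>t\<close> gives a polynomial curve from the
  identity to any given element.\<close>

lemma SL2_entire_curve:
  assumes g: "det g = 1" and h: "det h = 1"
  obtains G where "entire.entries_in G" "G 0 = g" "G 1 = h" "\<And>t. det (G t) = 1"
proof -
  have "det (adjugate2 g ** h) = 1" using g h by (simp add: det_mul)
  then obtain x y z w where
    f: "adjugate2 g ** h = mat2 1 x 0 1 ** mat2 1 0 y 1 ** mat2 1 z 0 1 ** mat2 1 0 w 1"
    by (rule elementary_factorization)
  define E where "E t = mat2 1 (t * x) 0 1 ** mat2 1 0 (t * y) 1 ** mat2 1 (t * z) 0 1 ** mat2 1 0 (t * w) 1"
    for t
  show ?thesis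
  proof
    show "entire.entries_in (\<lambda>t. g ** E t)"
      unfolding E_def
      by (intro entire.entries_in_mult entire.entries_in_const entire.entries_in_mat2)
         (auto intro: holomorphic_intros)
    show "g ** E 0 = g" by (simp add: E_def mat_eq_mat2[symmetric])
    have "g ** (adjugate2 g ** h) = h" by (simp add: matrix_mul_assoc adjugate2_mult[OF g])
    then show "g ** E 1 = h" using f by (simp add: E_def)
    show "det (g ** E t) = 1" for t by (simp add: E_def det_mul g det_mat2)
  qed
qed

section \<open>Irreducible components of a finite union\<close>

lemma irreducible_in_finite_union:
  assumes "finite \<Z>" "irreducible_in T Z" "\<And>X. X \<in> \<Z> \<Longrightarrow> closedin T X" "Z \<subseteq> \<Union>\<Z>"
  shows "\<exists>X\<in>\<Z>. Z \<subseteq> X"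
  using assms
proof (induction \<Z>)
  case empty
  then show ?case by (auto simp: irreducible_in_def)
next
  case (insert X \<Z>)
  have "closedin T (\<Union>\<Z>)" using insert by (intro closedin_Union) auto
  then have "Z \<subseteq> X \<or> Z \<subseteq> \<Union>\<Z>"
    using insert.prems unfolding irreducible_in_def by (metis Union_insert insertI1)
  with insert show ?case by auto
qed

text \<open>An irreducible subset of the union of finitely many closed sets is contained in one of them, so
  the members of an antichain of irreducible closed sets are the maximal irreducible subsets.\<close>

lemma irreducible_components_Union:
  assumes fin: "finite \<Z>"
    and closed: "\<And>X. X \<in> \<Z> \<Longrightarrow> closedin T X"
    and irr: "\<And>X. X \<in> \<Z> \<Longrightarrow> irreducible_in T X"
    and antichain: "\<And>X Y. X \<in> \<Z> \<Longrightarrow> Y \<in> \<Z> \<Longrightarrow> X \<subseteq> Y \<Longrightarrow> X = Y"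
  shows "irreducible_components T (\<Union>\<Z>) = \<Z>"
proof (intro equalityI subsetI)
  fix Z assume "Z \<in> irreducible_components T (\<Union>\<Z>)"
  then have Z: "Z \<subseteq> \<Union>\<Z>" "irreducible_in T Z"
    and max: "\<And>Z'. Z' \<subseteq> \<Union>\<Z> \<Longrightarrow> irreducible_in T Z' \<Longrightarrow> Z \<subseteq> Z' \<Longrightarrow> Z' = Z"
    by (auto simp: irreducible_components_def)
  obtain X where X: "X \<in> \<Z>" "Z \<subseteq> X"
    using irreducible_in_finite_union[OF fin Z(2) closed Z(1)] by blast
  with max[of X] irr show "Z \<in> \<Z>" by (metis Union_upper)
next
  fix Z assume Z: "Z \<in> \<Z>"
  have "Z' = Z" if Z': "Z' \<subseteq> \<Union>\<Z>" "irreducible_in T Z'" "Z \<subseteq> Z'" for Z'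
  proof -
    obtain X where X: "X \<in> \<Z>" "Z' \<subseteq> X"
      using irreducible_in_finite_union[OF fin Z'(2) closed Z'(1)] by blast
    with antichain[OF Z X(1)] Z'(3) show ?thesis by blast
  qed
  with Z irr show "Z \<in> irreducible_components T (\<Union>\<Z>)"
    by (auto simp: irreducible_components_def)
qed

lemma closedin_zariski_zero:
  assumes "f \<in> polynomial_functions" shows "closedin zariski {P. f P = 0}"
  unfolding closedin_zariski_iff using assms
  by (intro exI[of _ "{f}"]) (auto simp: zero_locus_def)

lemma closedin_zariski_eq:
  assumes "f \<in> polynomial_functions" shows "closedin zariski {P. f P = c}"
  using closedin_zariski_zero[OF poly.diff[OF assms poly.const[of c]]] by simp

lemma closedin_zariski_matrix_eq:
  assumes "poly.entries_in M" "poly.entries_in N"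
  shows "closedin zariski {P. M P = N P}"
proof -
  have "{P. M P = N P} = (\<Inter>i. \<Inter>j. {P. M P $ i $ j - N P $ i $ j = 0})"
    by (auto simp: vec_eq_iff)
  also have "closedin zariski \<dots>"
    by (intro closedin_INT closedin_zariski_zero poly.diff poly.entries_inD assms) auto
  finally show ?thesis .
qed

section \<open>Representations as pairs of matrices\<close>

context group
begin

lemma inv_commute:
  assumes "x \<otimes> y = y \<otimes> x" "x \<in> carrier G" "y \<in> carrier G"
  shows "inv x \<otimes> y = y \<otimes> inv x"
  using assms by (metis inv_closed inv_solve_left inv_solve_right' m_assoc m_closed)

text \<open>Used twice, this passes from commuting generators to an abelian image: first \<open>h\<close> is the
  image of a generator, then the value of a word.\<close>

lemma eval_word_commute:
  assumes f: "range f \<subseteq> carrier G" and h: "h \<in> carrier G"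
    and comm: "\<And>g. f g \<otimes> h = h \<otimes> f g"
  shows "eval_word G f w \<otimes> h = h \<otimes> eval_word G f w"
proof (induction w)
  case Nil
  then show ?case using h by simp
next
  case (Cons a w)
  obtain g s where a: "a = (g, s)" by (cases a)
  have fg: "f g \<in> carrier G" using f by auto
  let ?l = "if s then f g else inv f g"
  have l: "?l \<in> carrier G" using fg by simp
  have "inv f g \<otimes> h = h \<otimes> inv f g"
    by (rule inv_commute[OF comm fg h])
  then have lh: "?l \<otimes> h = h \<otimes> ?l" using comm by simp
  have ew: "eval_word G f w \<in> carrier G" by (rule eval_word_closed[OF f])
  have "?l \<otimes> eval_word G f w \<otimes> h = (?l \<otimes> h) \<otimes> eval_word G f w"
    using l h ew Cons by (simp add: m_assoc)
  also have "\<dots> = h \<otimes> (?l \<otimes> eval_word G f w)"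
    unfolding lh using l h ew by (simp add: m_assoc)
  finally show ?case by (simp add: a)
qed

end

lemma eval_word_eigenvector:
  assumes f: "range f \<subseteq> carrier SL2" and v: "v \<noteq> 0"
    and ev: "\<And>g. \<exists>c. f g *v v = c *s v"
  shows "\<exists>c. eval_word SL2 f w *v v = c *s v"
proof (induction w)
  case Nil
  show ?case by (intro exI[of _ 1]) simp
next
  case (Cons a w)
  obtain g s where a: "a = (g, s)" by (cases a)
  have fg: "det (f g) = 1" using f by (auto simp del: carrier_SL2 simp: carrier_SL2[symmetric])
  obtain c where c: "f g *v v = c *s v" using ev by blast
  have v': "v = adjugate2 (f g) *v (f g *v v)"
    by (simp add: matrix_vector_mul_assoc adjugate2_mult[OF fg])
  then have v'': "v = c *s (adjugate2 (f g) *v v)" by (simp add: c vector_scalar_commute)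
  with v have "c \<noteq> 0" by auto
  then have "adjugate2 (f g) *v v = inverse c *s v"
    by (subst (2) v'') (simp add: vector_smult_assoc)
  with c have "\<exists>b. (if s then f g else inv\<^bsub>SL2\<^esub> f g) *v v = b *s v"
    by (auto simp: inv_SL2[OF fg])
  then obtain b where b: "(if s then f g else inv\<^bsub>SL2\<^esub> f g) *v v = b *s v" ..
  obtain k where k: "eval_word SL2 f w *v v = k *s v" using Cons ..
  have "eval_word SL2 f (a # w) *v v = (if s then f g else inv\<^bsub>SL2\<^esub> f g) *v (eval_word SL2 f w *v v)"
    by (simp add: a matrix_vector_mul_assoc)
  also have "\<dots> = (k * b) *s v" unfolding k vector_scalar_commute b by (simp add: vector_smult_assoc)
  finally show ?case by blast
qed

lemma rep_variety_iff:
  "(A, B) \<in> rep_variety m n \<longleftrightarrow> det A = 1 \<and> det B = 1 \<and> A [^]\<^bsub>SL2\<^esub> m = B [^]\<^bsub>SL2\<^esub> n"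
  by (simp add: rep_variety_eq)

definition generator_images :: "int \<Rightarrow> int \<Rightarrow> (gen word set \<Rightarrow> complex^2^2) \<Rightarrow> gen \<Rightarrow> complex^2^2" where
  "generator_images m n \<rho> g = \<rho> (word_class (relations_G m n) [(g, True)])"

lemma representation_eval:
  assumes "\<rho> \<in> hom (G_grp m n) SL2"
  shows "range (generator_images m n \<rho>) \<subseteq> carrier SL2"
    and "\<rho> (word_class (relations_G m n) w) = eval_word SL2 (generator_images m n \<rho>) w"
    and "generator_images m n \<rho> Gen_x = \<rho> (x_G m n)" "generator_images m n \<rho> Gen_y = \<rho> (y_G m n)"
proof -
  show "range (generator_images m n \<rho>) \<subseteq> carrier SL2"
    using assms by (auto simp: G_grp_def hom_def generator_images_def)
  show "\<rho> (word_class (relations_G m n) w) = eval_word SL2 (generator_images m n \<rho>) w"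
    using SL2.presented_group_hom_eval[OF assms[unfolded G_grp_def], of w]
    by (simp add: generator_images_def[abs_def])
qed (simp_all add: generator_images_def x_G_def y_G_def)

lemma generators_in_carrier: "x_G m n \<in> carrier (G_grp m n)" "y_G m n \<in> carrier (G_grp m n)"
  by (simp_all add: G_grp_def x_G_def y_G_def)

lemma Ab_eq: "Ab m n = {(A, B). (A, B) \<in> rep_variety m n \<and> A ** B = B ** A}"
proof (intro equalityI subsetI)
  fix P assume "P \<in> Ab m n"
  then show "P \<in> {(A, B). (A, B) \<in> rep_variety m n \<and> A ** B = B ** A}"
    using generators_in_carrier by (auto simp: Ab_def rep_variety_def abelian_image_def)
next
  fix P assume "P \<in> {(A, B). (A, B) \<in> rep_variety m n \<and> A ** B = B ** A}"
  then obtain \<rho> where \<rho>: "\<rho> \<in> hom (G_grp m n) SL2" "P = (\<rho> (x_G m n), \<rho> (y_G m n))"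
    and comm: "\<rho> (x_G m n) ** \<rho> (y_G m n) = \<rho> (y_G m n) ** \<rho> (x_G m n)"
    by (auto simp: rep_variety_def)
  note eval = representation_eval[OF \<rho>(1)]
  let ?f = "generator_images m n \<rho>"
  have gens: "?f g ** ?f h = ?f h ** ?f g" for g h
    by (cases g; cases h) (simp_all add: eval comm)
  have carrier: "?f g \<in> carrier SL2" for g using eval(1) by blast
  have one: "eval_word SL2 ?f w ** ?f g = ?f g ** eval_word SL2 ?f w" for w g
    using SL2.eval_word_commute[OF eval(1) carrier[of g], of w] gens by simp
  have "eval_word SL2 ?f w ** eval_word SL2 ?f u = eval_word SL2 ?f u ** eval_word SL2 ?f w" for u w
    using SL2.eval_word_commute[OF eval(1) SL2.eval_word_closed[OF eval(1), of u], of w] one by simp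
  then have "abelian_image (G_grp m n) \<rho>"
    by (auto simp: abelian_image_def G_grp_def eval(2))
  with \<rho> show "P \<in> Ab m n" by (auto simp: Ab_def)
qed

text \<open>A common eigenvector of the images of the two generators is an eigenvector of the whole image,
  and commuting matrices have one.\<close>

lemma Irr_noncommuting:
  assumes "(A, B) \<in> Irr m n"
  shows "(A, B) \<in> rep_variety m n" and "A ** B \<noteq> B ** A"
proof -
  from assms obtain \<rho> where \<rho>: "\<rho> \<in> hom (G_grp m n) SL2" "irreducible_rep (G_grp m n) \<rho>"
    and AB: "A = \<rho> (x_G m n)" "B = \<rho> (y_G m n)"
    by (auto simp: Irr_def)
  note eval = representation_eval[OF \<rho>(1)]
  show R: "(A, B) \<in> rep_variety m n" using \<rho> AB by (auto simp: rep_variety_def)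
  show "A ** B \<noteq> B ** A"
  proof
    assume "A ** B = B ** A"
    moreover have "det A = 1" "det B = 1" using R by (auto simp: rep_variety_iff)
    ultimately obtain v a b where v: "v \<noteq> 0" "A *v v = a *s v" "B *v v = b *s v"
      by (rule commuting_common_eigenvector)
    have "\<exists>c. generator_images m n \<rho> g *v v = c *s v" for g
      using v by (cases g) (auto simp: eval AB)
    from eval_word_eigenvector[OF eval(1) v(1) this]
    have "\<forall>g\<in>carrier (G_grp m n). \<exists>c. \<rho> g *v v = c *s v" by (auto simp: G_grp_def eval(2))
    with v(1) \<rho>(2) show False unfolding irreducible_rep_def by blast
  qed
qed

text \<open>A common eigenvector of \<open>A\<close> and \<open>B\<close> lies in the kernel of \<open>A B - B A\<close>.\<close>

lemma det_commutator_imp_Irr: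
  assumes R: "(A, B) \<in> rep_variety m n" and det: "det (A ** B - B ** A) \<noteq> 0"
  shows "(A, B) \<in> Irr m n"
proof -
  from R obtain \<rho> where \<rho>: "\<rho> \<in> hom (G_grp m n) SL2"
    and AB: "A = \<rho> (x_G m n)" "B = \<rho> (y_G m n)"
    by (auto simp: rep_variety_def)
  have "irreducible_rep (G_grp m n) \<rho>"
    unfolding irreducible_rep_def
  proof clarify
    fix v assume v: "v \<noteq> 0" "\<forall>g\<in>carrier (G_grp m n). \<exists>c. \<rho> g *v v = c *s v"
    then obtain a b where ab: "A *v v = a *s v" "B *v v = b *s v"
      using generators_in_carrier AB by blast
    have "(A ** B - B ** A) *v v = A *v (B *v v) - B *v (A *v v)"
      by (simp add: matrix_vector_mult_diff_rdistrib matrix_vector_mul_assoc)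
    also have "\<dots> = 0" by (simp add: ab vector_scalar_commute vector_smult_assoc mult.commute)
    finally have "(A ** B - B ** A) *v v = 0" .
    moreover have "invertible (A ** B - B ** A)" using det by (simp add: invertible_det_nz)
    ultimately show False using v(1)
      by (metis invertible_def matrix_vector_mul_assoc matrix_vector_mul_lid matrix_vector_mult_0_right)
  qed
  with \<rho> AB show ?thesis by (auto simp: Irr_def)
qed

section \<open>The pieces with prescribed traces\<close>

definition trace_piece :: "complex \<Rightarrow> complex \<Rightarrow> matrix_pair set" where
  "trace_piece a b = {(A, B). det A = 1 \<and> det B = 1 \<and> trace A = a \<and> trace B = b}"

lemma closedin_trace_piece: "closedin zariski (trace_piece a b)"
proof -
  have "trace_piece a b = {P. det (fst P) = 1} \<inter> {P. det (snd P) = 1} \<inter>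
      {P. trace (fst P) = a} \<inter> {P. trace (snd P) = b}"
    by (auto simp: trace_piece_def)
  also have "closedin zariski \<dots>"
    by (intro closedin_Int closedin_zariski_eq poly.det_in poly.trace_in poly_entries_fst poly_entries_snd)
  finally show ?thesis .
qed

text \<open>The commutator has zero diagonal, and its determinant is \<open>(z - 1/z)\<^sup>2\<close> times the product of
  the off-diagonal entries of the second matrix.\<close>

lemma trace_piece_generic_point:
  assumes "z \<noteq> 0" "z\<^sup>2 \<noteq> 1"
  obtains A B where "(A, B) \<in> trace_piece (z + inverse z) b" "det (A ** B - B ** A) \<noteq> 0"
proof
  let ?A = "diag2 z" and ?B = "mat2 b (- 1) 1 0"
  have "z - inverse z \<noteq> 0" using assms by (auto simp: field_simps power2_eq_square)
  then show "(?A, ?B) \<in> trace_piece (z + inverse z) b" "det (?A ** ?B - ?B ** ?A) \<noteq> 0"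
    using assms(1) by (auto simp: trace_piece_def mat2_simps diag2_def)
qed

text \<open>The piece is the product of two conjugacy classes of diagonal matrices, so its points can be
  joined by moving the two conjugating matrices through \<open>SL(2,\<complex>)\<close>.\<close>

lemma irreducible_trace_piece:
  assumes z: "z \<noteq> 0" "z\<^sup>2 \<noteq> 1" and w: "w \<noteq> 0" "w\<^sup>2 \<noteq> 1"
  shows "irreducible_in zariski (trace_piece (z + inverse z) (w + inverse w))"
proof (rule irreducible_in_zariskiI)
  show "trace_piece (z + inverse z) (w + inverse w) \<noteq> {}"
    using trace_piece_generic_point[OF z] by blast
next
  fix A0 B0 A1 B1
  assume P: "(A0, B0) \<in> trace_piece (z + inverse z) (w + inverse w)"
    "(A1, B1) \<in> trace_piece (z + inverse z) (w + inverse w)"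
  have curve: "\<exists>A. entire.entries_in A \<and> A 0 = A0 \<and> A 1 = A1 \<and>
      (\<forall>t. det (A t) = 1 \<and> trace (A t) = u + inverse u)"
    if dets: "det A0 = 1" "det A1 = 1"
      and traces: "trace A0 = u + inverse u" "trace A1 = u + inverse u"
      and u: "u \<noteq> 0" "u\<^sup>2 \<noteq> 1"
    for A0 A1 u
  proof -
    obtain g where g: "det g = 1" "A0 = conjugate g (diag2 u)"
      using diagonalize[OF dets(1) traces(1) u] .
    obtain h where h: "det h = 1" "A1 = conjugate h (diag2 u)"
      using diagonalize[OF dets(2) traces(2) u] .
    obtain G where G: "entire.entries_in G" "G 0 = g" "G 1 = h" "\<And>t. det (G t) = 1"
      using SL2_entire_curve[OF g(1) h(1)] by blast
    have "trace (diag2 u) = u + inverse u" by (simp add: diag2_def trace_mat2)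
    with G g h u show ?thesis
      by (intro exI[of _ "\<lambda>t. conjugate (G t) (diag2 u)"])
        (auto simp: det_conjugate trace_conjugate entire.entries_in_conjugate entire.entries_in_const)
  qed
  obtain A where A: "entire.entries_in A" "A 0 = A0" "A 1 = A1"
    "\<forall>t. det (A t) = 1 \<and> trace (A t) = z + inverse z"
    using curve[of A0 A1 z] P z by (auto simp: trace_piece_def)
  obtain B where B: "entire.entries_in B" "B 0 = B0" "B 1 = B1"
    "\<forall>t. det (B t) = 1 \<and> trace (B t) = w + inverse w"
    using curve[of B0 B1 w] P w by (auto simp: trace_piece_def)
  have "\<forall>t. (A t, B t) \<in> trace_piece (z + inverse z) (w + inverse w)"
    using A(4) B(4) by (simp add: trace_piece_def)
  with A B show "\<exists>A B. entire.entries_in A \<and> entire.entries_in B \<and> A 0 = A0 \<and> B 0 = B0 \<and>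
        A 1 = A1 \<and> B 1 = B1 \<and> (\<forall>t. (A t, B t) \<in> trace_piece (z + inverse z) (w + inverse w))"
    by blast
qed

lemma scalar_commute: "X ** mat k = mat k ** X" for X :: "complex^2^2"
  by (cases X rule: mat2_cases) (simp add: mat2_simps mult.commute)

text \<open>Since \<open>e\<close> is its own inverse, the sign of the exponent can be dropped.\<close>

lemma int_pow_scalar_iff:
  assumes "det A = 1" "e\<^sup>2 = 1"
  shows "A [^]\<^bsub>SL2\<^esub> (k :: int) = mat e \<longleftrightarrow> A [^]\<^bsub>SL2\<^esub> nat \<bar>k\<bar> = mat e"
proof (cases "k < 0")
  case True
  have d: "det (mat e :: complex^2^2) = 1" using assms(2) by (simp add: mat2_simps power2_eq_square)
  then have inv: "inv\<^bsub>SL2\<^esub> (mat e) = mat e"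
    by (simp add: inv_SL2) (simp add: mat_eq_mat2 adjugate2_mat2)
  define X where "X = A [^]\<^bsub>SL2\<^esub> nat \<bar>k\<bar>"
  have "X \<in> carrier SL2"
    unfolding X_def using assms(1) by (intro SL2.nat_pow_closed) simp
  then have "inv\<^bsub>SL2\<^esub> (inv\<^bsub>SL2\<^esub> X) = X" by (rule SL2.inv_inv)
  with inv have "inv\<^bsub>SL2\<^esub> X = mat e \<longleftrightarrow> X = mat e" by metis
  moreover have "A [^]\<^bsub>SL2\<^esub> k = inv\<^bsub>SL2\<^esub> X"
    using True by (simp only: int_pow_def2 X_def if_True abs_of_neg)
  ultimately show ?thesis unfolding X_def by simp
next
  case False
  then have "A [^]\<^bsub>SL2\<^esub> k = A [^]\<^bsub>SL2\<^esub> nat \<bar>k\<bar>"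
    by (simp only: int_pow_def2 if_False) simp
  then show ?thesis by simp
qed

text \<open>The image of the central element \<open>x\<^sup>m = y\<^sup>n\<close> is scalar, since otherwise \<open>A\<close> and \<open>B\<close> would lie in
  its commutative centralizer. The scalar has square one because the determinant is one, and the
  eigenvalues are not \<open>1\<close> or \<open>-1\<close> because \<open>A\<close> and \<open>B\<close> are not scalar, whereas a
  power of each is.\<close>

lemma noncommuting_trace_piece:
  assumes m: "m \<noteq> 0" and n: "n \<noteq> 0" and R: "(A, B) \<in> rep_variety m n" and AB: "A ** B \<noteq> B ** A"
  obtains e z w where "e\<^sup>2 = 1" "z ^ nat \<bar>m\<bar> = e" "z\<^sup>2 \<noteq> 1" "w ^ nat \<bar>n\<bar> = e" "w\<^sup>2 \<noteq> 1"
    "(A, B) \<in> trace_piece (z + inverse z) (w + inverse w)"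
proof -
  have det: "det A = 1" "det B = 1" and eq: "A [^]\<^bsub>SL2\<^esub> m = B [^]\<^bsub>SL2\<^esub> n"
    using R by (auto simp: rep_variety_iff)
  have comm: "X [^]\<^bsub>SL2\<^esub> k ** X = X ** X [^]\<^bsub>SL2\<^esub> k" if "det X = 1" for X and k :: int
  proof -
    from that have X: "X \<in> carrier SL2" by simp
    have "X [^]\<^bsub>SL2\<^esub> (k + 1) = X [^]\<^bsub>SL2\<^esub> k ** X"
      using SL2.int_pow_mult[OF X, of k 1] unfolding SL2.int_pow_1[OF X] mult_SL2 .
    moreover have "X [^]\<^bsub>SL2\<^esub> (k + 1) = X ** X [^]\<^bsub>SL2\<^esub> k"
      using SL2.int_pow_mult[OF X, of 1 k] unfolding SL2.int_pow_1[OF X] mult_SL2 add.commute[of 1 k] .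
    ultimately show ?thesis by metis
  qed
  have "\<exists>e. A [^]\<^bsub>SL2\<^esub> m = mat e"
  proof (rule ccontr)
    assume "\<nexists>e. A [^]\<^bsub>SL2\<^esub> m = mat e"
    then have "A [^]\<^bsub>SL2\<^esub> m \<noteq> mat k" for k by blast
    from centralizer_of_nonscalar_commutative[OF this comm[OF det(1), of m, symmetric]
        comm[OF det(2), of n, symmetric, folded eq]] AB
    show False by contradiction
  qed
  then obtain e where e: "A [^]\<^bsub>SL2\<^esub> m = mat e" ..
  have "A [^]\<^bsub>SL2\<^esub> m \<in> carrier SL2" using det by (intro SL2.int_pow_closed) simp
  then have e2: "e\<^sup>2 = 1" unfolding e by (simp add: mat2_simps power2_eq_square)
  have Apow: "A [^]\<^bsub>SL2\<^esub> nat \<bar>m\<bar> = mat e" using e int_pow_scalar_iff[OF det(1) e2] by blast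
  have Bpow: "B [^]\<^bsub>SL2\<^esub> nat \<bar>n\<bar> = mat e" using e eq int_pow_scalar_iff[OF det(2) e2] by metis
  have nsA: "A \<noteq> mat k" for k
  proof
    assume "A = mat k"
    then have "A ** B = B ** A" by (simp only: scalar_commute[of B k])
    with AB show False ..
  qed
  have nsB: "B \<noteq> mat k" for k
  proof
    assume "B = mat k"
    then have "A ** B = B ** A" by (simp only: scalar_commute[of A k])
    with AB show False ..
  qed
  obtain z where z: "z \<noteq> 0" "z + inverse z = trace A" using exists_reciprocal_sum by blast
  obtain w where w: "w \<noteq> 0" "w + inverse w = trace B" using exists_reciprocal_sum by blast
  have zp: "z ^ nat \<bar>m\<bar> = e" "z\<^sup>2 \<noteq> 1"
    using scalar_power_cases[OF det(1) Apow _ z(2)[symmetric] z(1)] m nsA by auto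
  have wp: "w ^ nat \<bar>n\<bar> = e" "w\<^sup>2 \<noteq> 1"
    using scalar_power_cases[OF det(2) Bpow _ w(2)[symmetric] w(1)] n nsB by auto
  show ?thesis
    using that[OF e2 zp wp] z w det by (simp add: trace_piece_def)
qed

lemma trace_piece_subset:
  assumes e: "e\<^sup>2 = 1" and z: "z ^ nat \<bar>m\<bar> = e" "z \<noteq> 0" "z\<^sup>2 \<noteq> 1"
    and w: "w ^ nat \<bar>n\<bar> = e" "w \<noteq> 0" "w\<^sup>2 \<noteq> 1"
  shows "trace_piece (z + inverse z) (w + inverse w) \<subseteq> rep_variety m n"
proof clarify
  fix A B assume AB: "(A, B) \<in> trace_piece (z + inverse z) (w + inverse w)"
  have pow: "X [^]\<^bsub>SL2\<^esub> k = mat e"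
    if X: "det X = 1" "trace X = u + inverse u" "u ^ nat \<bar>k\<bar> = e" "u \<noteq> 0" "u\<^sup>2 \<noteq> 1"
    for X u and k :: int
  proof -
    obtain g where g: "det g = 1" "X = conjugate g (diag2 u)"
      using diagonalize[OF X(1,2,4,5)] .
    have "inverse e = e" using e by (metis inverse_unique power2_eq_square)
    then have "diag2 e = mat e" by (simp add: diag2_def mat_eq_mat2)
    then have "diag2 u [^]\<^bsub>SL2\<^esub> nat \<bar>k\<bar> = mat e" by (simp add: diag2_nat_pow X(3))
    moreover have "conjugate g (mat e) = mat e"
      unfolding conjugate_def scalar_commute[of g] matrix_mul_assoc[symmetric] adjugate2_mult(1)[OF g(1)]
      by simp
    ultimately have "X [^]\<^bsub>SL2\<^esub> nat \<bar>k\<bar> = mat e" by (simp only: g(2) conjugate_nat_pow[OF g(1)])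
    then show ?thesis using int_pow_scalar_iff[OF X(1) e] by blast
  qed
  have "A [^]\<^bsub>SL2\<^esub> m = mat e" using AB z by (intro pow[of A z]) (auto simp: trace_piece_def)
  moreover have "B [^]\<^bsub>SL2\<^esub> n = mat e" using AB w by (intro pow[of B w]) (auto simp: trace_piece_def)
  ultimately show "(A, B) \<in> rep_variety m n" using AB by (simp add: rep_variety_iff trace_piece_def)
qed

section \<open>The pieces of the commuting locus\<close>

context group
begin

lemma int_pow_commute:
  assumes "x \<otimes> y = y \<otimes> x" "x \<in> carrier G" "y \<in> carrier G"
  shows "x [^] (i :: int) \<otimes> y = y \<otimes> x [^] i"
proof -
  have "x [^] j \<otimes> y = y \<otimes> x [^] j" for j :: nat
    using group_commutes_pow[OF assms] .
  then show ?thesis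
    using inv_commute[of "x [^] nat (- i)" y] assms(2,3) nat_pow_closed[OF assms(2)]
    unfolding int_pow_def2 by presburger
qed

lemma int_pow_int_pow_commute:
  assumes "x \<otimes> y = y \<otimes> x" "x \<in> carrier G" "y \<in> carrier G"
  shows "x [^] (i :: int) \<otimes> y [^] (j :: int) = y [^] j \<otimes> x [^] i"
  using int_pow_commute[OF int_pow_commute[OF assms, symmetric] assms(3)
      int_pow_closed[OF assms(2)], of j i] by metis

lemma monomial_mult:
  assumes "x \<otimes> y = y \<otimes> x" "x \<in> carrier G" "y \<in> carrier G"
  shows "(x [^] (p :: int) \<otimes> y [^] (q :: int)) \<otimes> (x [^] (r :: int) \<otimes> y [^] (s :: int))
    = x [^] (p + r) \<otimes> y [^] (q + s)"
proof -
  note [simp] = assms(2,3)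
  have "(x [^] p \<otimes> y [^] q) \<otimes> (x [^] r \<otimes> y [^] s) = x [^] p \<otimes> (y [^] q \<otimes> x [^] r) \<otimes> y [^] s"
    by (simp only: m_assoc m_closed int_pow_closed assms(2,3))
  also have "y [^] q \<otimes> x [^] r = x [^] r \<otimes> y [^] q"
    using int_pow_int_pow_commute[OF assms] by metis
  also have "x [^] p \<otimes> (x [^] r \<otimes> y [^] q) \<otimes> y [^] s = (x [^] p \<otimes> x [^] r) \<otimes> (y [^] q \<otimes> y [^] s)"
    by (simp only: m_assoc m_closed int_pow_closed assms(2,3))
  finally show ?thesis by (simp only: int_pow_mult assms(2,3))
qed

lemma monomial_pow:
  assumes "x \<otimes> y = y \<otimes> x" "x \<in> carrier G" "y \<in> carrier G"
  shows "(x [^] (p :: int) \<otimes> y [^] (q :: int)) [^] (i :: int) = x [^] (p * i) \<otimes> y [^] (q * i)"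
  using int_pow_mult_distrib[OF int_pow_int_pow_commute[OF assms], of p q i] assms(2,3)
  by (simp only: int_pow_closed int_pow_pow)

text \<open>For commuting \<open>x\<close> and \<open>y\<close> the monomials \<open>x\<^sup>p y\<^sup>q\<close> behave like integer vectors \<open>(p, q)\<close>, and a
  substitution of monomials acts on exponents by an integer matrix.\<close>

lemma monomial_of_monomials:
  assumes "x \<otimes> y = y \<otimes> x" "x \<in> carrier G" "y \<in> carrier G"
  shows "(x [^] (p :: int) \<otimes> y [^] (q :: int)) [^] (i :: int) \<otimes> (x [^] (r :: int) \<otimes> y [^] (s :: int)) [^] (j :: int)
    = x [^] (p * i + r * j) \<otimes> y [^] (q * i + s * j)"
  by (simp only: monomial_pow[OF assms] monomial_mult[OF assms])

lemma monomials_commute: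
  assumes "x \<otimes> y = y \<otimes> x" "x \<in> carrier G" "y \<in> carrier G"
  shows "(x [^] (p :: int) \<otimes> y [^] (q :: int)) \<otimes> (x [^] (r :: int) \<otimes> y [^] (s :: int))
    = (x [^] r \<otimes> y [^] s) \<otimes> (x [^] p \<otimes> y [^] q)"
  by (simp only: monomial_mult[OF assms] add.commute)

lemma monomial_torsion_iff:
  assumes "x \<otimes> y = y \<otimes> x" "x \<in> carrier G" "y \<in> carrier G"
  shows "(x [^] (p :: int) \<otimes> y [^] (- q :: int)) [^] (k :: nat) = \<one> \<longleftrightarrow>
    x [^] (int k * p) = y [^] (int k * q)"
proof -
  have "(x [^] p \<otimes> y [^] (- q)) [^] k = x [^] (p * int k) \<otimes> y [^] (- q * int k)"
    unfolding monomial_pow[OF assms, symmetric] by (rule int_pow_int[symmetric])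
  also have "\<dots> = x [^] (int k * p) \<otimes> inv (y [^] (int k * q))"
    using int_pow_neg[OF assms(3), of "int k * q"] by (simp only: mult.commute mult_minus_left mult_minus_right)
  finally show ?thesis
    using inv_solve_right'[of "\<one>" "x [^] (int k * p)" "y [^] (int k * q)"] assms(2,3)
    by (metis int_pow_closed l_one one_closed)
qed

end

text \<open>The matrix \<open>C = A\<^sup>p B\<^sup>-\<^sup>q\<close> is the obstruction to \<open>A\<^sup>p = B\<^sup>q\<close>. The relation
  \<open>A\<^sup>k\<^sup>p = B\<^sup>k\<^sup>q\<close> only says that \<open>C\<^sup>k = 1\<close>, and the trace of \<open>C\<close> separates the pieces.\<close>

definition abelian_piece :: "nat \<Rightarrow> int \<Rightarrow> int \<Rightarrow> complex \<Rightarrow> matrix_pair set" where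
  "abelian_piece k p q c = {(A, B). det A = 1 \<and> det B = 1 \<and> A ** B = B ** A \<and>
     (A [^]\<^bsub>SL2\<^esub> p ** B [^]\<^bsub>SL2\<^esub> (- q)) [^]\<^bsub>SL2\<^esub> k = mat 1 \<and>
     trace (A [^]\<^bsub>SL2\<^esub> p ** B [^]\<^bsub>SL2\<^esub> (- q)) = c}"

lemma closedin_abelian_piece: "closedin zariski (abelian_piece k p q c)"
proof -
  define M where "M P = adjugate_power (fst P) p ** adjugate_power (snd P) (- q)" for P :: matrix_pair
  have M: "poly.entries_in M"
    unfolding M_def[abs_def]
    by (intro poly.entries_in_mult poly.entries_in_adjugate_power poly_entries_fst poly_entries_snd)
  have eq: "M (A, B) = A [^]\<^bsub>SL2\<^esub> p ** B [^]\<^bsub>SL2\<^esub> (- q)" if "det A = 1" "det B = 1" for A B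
    by (simp only: M_def fst_conv snd_conv adjugate_power_eq that)
  have "abelian_piece k p q c = {P. det (fst P) = 1} \<inter> {P. det (snd P) = 1} \<inter>
      {P. fst P ** snd P = snd P ** fst P} \<inter> {P. M P [^]\<^bsub>SL2\<^esub> k = mat 1} \<inter> {P. trace (M P) = c}"
    unfolding abelian_piece_def using eq by (auto split: prod.splits)
  also have "closedin zariski \<dots>"
    by (intro closedin_Int closedin_zariski_eq closedin_zariski_matrix_eq poly.det_in poly.trace_in
        poly_entries_fst poly_entries_snd M poly.entries_in_mult poly.entries_in_nat_pow poly.entries_in_const)
  finally show ?thesis .
qed

text \<open>These are the coordinates \<open>(C, T)\<close> on an abelian piece, in which \<open>T\<close> can be any element of
  \<open>SL(2,\<complex>)\<close> that commutes with \<open>C\<close>.\<close>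

definition torsion_pairs :: "nat \<Rightarrow> complex \<Rightarrow> matrix_pair set" where
  "torsion_pairs k c = {(C, T). det C = 1 \<and> det T = 1 \<and> C ** T = T ** C \<and>
     C [^]\<^bsub>SL2\<^esub> k = mat 1 \<and> trace C = c}"

lemma SL2_int_pow_closed: "det A = 1 \<Longrightarrow> det (A [^]\<^bsub>SL2\<^esub> (i :: int)) = 1"
  using SL2.int_pow_closed[of A i] by simp

text \<open>The substitutions \<open>C = A\<^sup>p B\<^sup>-\<^sup>q\<close>, \<open>T = A\<^sup>x B\<^sup>y\<close> and \<open>A = C\<^sup>y T\<^sup>q\<close>, \<open>B = C\<^sup>-\<^sup>x T\<^sup>p\<close> have inverse
  exponent matrices of determinant \<open>x q + y p = 1\<close>.\<close>

lemma abelian_piece_eq_torsion_pairs: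
  assumes bezout: "x * q + y * p = (1 :: int)"
  shows "abelian_piece k p q c = (\<lambda>(C, T). (C [^]\<^bsub>SL2\<^esub> y ** T [^]\<^bsub>SL2\<^esub> q, C [^]\<^bsub>SL2\<^esub> (- x) ** T [^]\<^bsub>SL2\<^esub> p)) `
    torsion_pairs k c" (is "_ = ?\<Phi> ` _")
proof (intro equalityI subsetI)
  fix P assume "P \<in> abelian_piece k p q c"
  then obtain A B where P: "P = (A, B)" and d: "det A = 1" "det B = 1" and comm: "A ** B = B ** A"
    and C: "(A [^]\<^bsub>SL2\<^esub> p ** B [^]\<^bsub>SL2\<^esub> (- q)) [^]\<^bsub>SL2\<^esub> k = mat 1"
      "trace (A [^]\<^bsub>SL2\<^esub> p ** B [^]\<^bsub>SL2\<^esub> (- q)) = c"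
    by (auto simp: abelian_piece_def)
  have AB: "A \<otimes>\<^bsub>SL2\<^esub> B = B \<otimes>\<^bsub>SL2\<^esub> A" "A \<in> carrier SL2" "B \<in> carrier SL2"
    using d comm by simp_all
  define C' where "C' = A [^]\<^bsub>SL2\<^esub> p ** B [^]\<^bsub>SL2\<^esub> (- q)"
  define T where "T = A [^]\<^bsub>SL2\<^esub> x ** B [^]\<^bsub>SL2\<^esub> y"
  have mon: "C' [^]\<^bsub>SL2\<^esub> i ** T [^]\<^bsub>SL2\<^esub> j = A [^]\<^bsub>SL2\<^esub> (p * i + x * j) ** B [^]\<^bsub>SL2\<^esub> (- q * i + y * j)" for i j :: int
    unfolding C'_def T_def using SL2.monomial_of_monomials[OF AB, of p "- q" i x y j] by (simp only: mult_SL2)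
  have "C' ** T = T ** C'"
    unfolding C'_def T_def using SL2.monomials_commute[OF AB, of p "- q" x y] by (simp only: mult_SL2)
  moreover have "det C' = 1" "det T = 1"
    by (simp_all only: C'_def T_def det_mul SL2_int_pow_closed d mult_1)
  ultimately have "(C', T) \<in> torsion_pairs k c"
    using C by (simp only: torsion_pairs_def C'_def[symmetric]) simp
  moreover have "p * y + x * q = 1" "- q * y + y * q = 0" "p * (- x) + x * p = 0" "- q * (- x) + y * p = 1"
    using bezout by (simp_all add: algebra_simps)
  then have "P = ?\<Phi> (C', T)"
    using AB(2,3) by (simp only: P prod.case mon SL2.int_pow_1 int_pow_0 one_SL2 matrix_mul_lid matrix_mul_rid)
  ultimately show "P \<in> ?\<Phi> ` torsion_pairs k c" by (rule rev_image_eqI)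
next
  fix P assume "P \<in> ?\<Phi> ` torsion_pairs k c"
  then obtain C T where P: "P = (C [^]\<^bsub>SL2\<^esub> y ** T [^]\<^bsub>SL2\<^esub> q, C [^]\<^bsub>SL2\<^esub> (- x) ** T [^]\<^bsub>SL2\<^esub> p)"
    and d: "det C = 1" "det T = 1" and comm: "C ** T = T ** C"
    and C: "C [^]\<^bsub>SL2\<^esub> k = mat 1" "trace C = c"
    by (auto simp: torsion_pairs_def)
  have CT: "C \<otimes>\<^bsub>SL2\<^esub> T = T \<otimes>\<^bsub>SL2\<^esub> C" "C \<in> carrier SL2" "T \<in> carrier SL2"
    using d comm by simp_all
  define A where "A = C [^]\<^bsub>SL2\<^esub> y ** T [^]\<^bsub>SL2\<^esub> q"
  define B where "B = C [^]\<^bsub>SL2\<^esub> (- x) ** T [^]\<^bsub>SL2\<^esub> p"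
  have "A [^]\<^bsub>SL2\<^esub> p ** B [^]\<^bsub>SL2\<^esub> (- q) = C [^]\<^bsub>SL2\<^esub> (y * p + - x * - q) ** T [^]\<^bsub>SL2\<^esub> (q * p + p * - q)"
    unfolding A_def B_def using SL2.monomial_of_monomials[OF CT, of y q p "- x" p "- q"] by (simp only: mult_SL2)
  moreover have "y * p + - x * - q = 1" "q * p + p * - q = 0" using bezout by (simp_all add: algebra_simps)
  ultimately have eq: "A [^]\<^bsub>SL2\<^esub> p ** B [^]\<^bsub>SL2\<^esub> (- q) = C"
    using CT(2,3) by (simp only: SL2.int_pow_1 int_pow_0 one_SL2 matrix_mul_rid)
  have "A ** B = B ** A"
    unfolding A_def B_def using SL2.monomials_commute[OF CT, of y q "- x" p] by (simp only: mult_SL2)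
  moreover have "det A = 1" "det B = 1"
    by (simp_all only: A_def B_def det_mul SL2_int_pow_closed d mult_1)
  ultimately have "(A, B) \<in> abelian_piece k p q c"
    unfolding abelian_piece_def mem_Collect_eq prod.case eq using C by blast
  then show "P \<in> abelian_piece k p q c" by (simp only: P A_def B_def)
qed

lemma mat_one_eq_diag2: "mat 1 = diag2 1"
  by (simp add: diag2_def mat_eq_mat2)

lemma diag2_torsion_pair:
  assumes "\<omega> ^ k = 1" "\<omega> \<noteq> 0" "u \<noteq> 0"
  shows "(diag2 \<omega>, diag2 u) \<in> torsion_pairs k (\<omega> + inverse \<omega>)"
  using assms by (simp add: torsion_pairs_def diag2_mult diag2_nat_pow mat_one_eq_diag2 mult.commute)
    (simp add: diag2_def trace_mat2)

lemma conjugate_torsion_pair: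
  assumes "det g = 1" "(C, T) \<in> torsion_pairs k c"
  shows "(conjugate g C, conjugate g T) \<in> torsion_pairs k c"
  using assms by (auto simp: torsion_pairs_def det_conjugate trace_conjugate conjugate_mult
      conjugate_nat_pow conjugate_one)

lemma diagonalize_torsion_pair:
  assumes CT: "(C, T) \<in> torsion_pairs k (\<omega> + inverse \<omega>)" and \<omega>: "\<omega> \<noteq> 0" "\<omega>\<^sup>2 \<noteq> 1"
  obtains g u where "det g = 1" "u \<noteq> 0" "C = conjugate g (diag2 \<omega>)" "T = conjugate g (diag2 u)"
proof -
  have d: "det C = 1" "det T = 1" "trace C = \<omega> + inverse \<omega>" and comm: "C ** T = T ** C"
    using CT by (auto simp: torsion_pairs_def)
  obtain g where g: "det g = 1" "C = conjugate g (diag2 \<omega>)"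
    using diagonalize[OF d(1,3) \<omega>] .
  define T' where "T' = conjugate (adjugate2 g) T"
  have T: "T = conjugate g T'" using g(1) by (simp add: T'_def conjugate_cancel)
  have "conjugate g (T' ** diag2 \<omega>) = conjugate g (diag2 \<omega> ** T')"
    using comm by (simp add: g(2) T conjugate_mult[OF g(1)])
  then have "T' ** diag2 \<omega> = diag2 \<omega> ** T'" by (simp add: conjugate_inj[OF g(1)])
  moreover have "det T' = 1" using d(2) g(1) by (simp add: T'_def det_conjugate)
  ultimately obtain u where "u \<noteq> 0" "T' = diag2 u"
    using commutes_with_diag2[of T' \<omega>] \<omega> by blast
  with g T that show ?thesis by blast
qed

text \<open>If \<open>\<omega>\<close> is \<open>1\<close> or \<open>-1\<close>, then \<open>C = \<omega>\<close> and \<open>T\<close> is an arbitrary element of \<open>SL(2,\<complex>)\<close>; this includes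
  the parabolic pairs. Otherwise \<open>C\<close> and \<open>T\<close> are simultaneously
  diagonal after a conjugation, and the curve moves the conjugating matrix and the eigenvalue
  of \<open>T\<close> at the same time.\<close>

lemma torsion_pairs_curve:
  assumes k: "k > 0" and \<omega>: "\<omega> ^ k = 1"
    and P0: "(C0, T0) \<in> torsion_pairs k (\<omega> + inverse \<omega>)"
    and P1: "(C1, T1) \<in> torsion_pairs k (\<omega> + inverse \<omega>)"
  shows "\<exists>C T. entire.entries_in C \<and> entire.entries_in T \<and> C 0 = C0 \<and> T 0 = T0 \<and> C 1 = C1 \<and> T 1 = T1 \<and>
    (\<forall>t. (C t, T t) \<in> torsion_pairs k (\<omega> + inverse \<omega>))"
proof -
  have nz: "\<omega> \<noteq> 0" using k \<omega> by (auto simp: power_0_left)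
  show ?thesis
  proof (cases "\<omega>\<^sup>2 = 1")
    case True
    have scalar: "C = mat \<omega>" if "(C, T) \<in> torsion_pairs k (\<omega> + inverse \<omega>)" for C T
      using that by (intro scalar_power_cases(2)[OF _ _ k _ nz True]) (auto simp: torsion_pairs_def)
    have d: "det T0 = 1" "det T1 = 1" using P0 P1 by (auto simp: torsion_pairs_def)
    obtain T where T: "entire.entries_in T" "T 0 = T0" "T 1 = T1" "\<And>t. det (T t) = 1"
      using SL2_entire_curve[OF d] by blast
    have "(mat \<omega>, T t) \<in> torsion_pairs k (\<omega> + inverse \<omega>)" for t
    proof -
      have "(mat \<omega>, T0) \<in> torsion_pairs k (\<omega> + inverse \<omega>)" using P0 scalar[OF P0] by metis
      then show ?thesis
        unfolding torsion_pairs_def mem_Collect_eq prod.case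
        using T(4)[of t] scalar_commute[of "T t" \<omega>] by metis
    qed
    with T scalar[OF P0] scalar[OF P1] show ?thesis
      by (intro exI[of _ "\<lambda>_. mat \<omega>"] exI[of _ T]) (auto intro: entire.entries_in_const)
  next
    case False
    obtain g u where g: "det g = 1" "u \<noteq> 0" "C0 = conjugate g (diag2 \<omega>)" "T0 = conjugate g (diag2 u)"
      using diagonalize_torsion_pair[OF P0 nz False] .
    obtain h v where h: "det h = 1" "v \<noteq> 0" "C1 = conjugate h (diag2 \<omega>)" "T1 = conjugate h (diag2 v)"
      using diagonalize_torsion_pair[OF P1 nz False] .
    obtain G where G: "entire.entries_in G" "G 0 = g" "G 1 = h" "\<And>t. det (G t) = 1"
      using SL2_entire_curve[OF g(1) h(1)] by blast
    \<comment> \<open>an entire curve from \<open>u\<close> to \<open>v\<close> that avoids \<open>0\<close>\<close>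
    define w where "w t = exp ((1 - t) * ln u + t * ln v)" for t
    have w: "w 0 = u" "w 1 = v" "\<And>t. w t \<noteq> 0" using g(2) h(2) by (simp_all add: w_def)
    have "entire.entries_in (\<lambda>t. diag2 (w t))"
      unfolding diag2_def using w(3)
      by (intro entire.entries_in_mat2) (auto simp: w_def intro!: holomorphic_intros)
    with G(1) have "entire.entries_in (\<lambda>t. conjugate (G t) (diag2 (w t)))"
      "entire.entries_in (\<lambda>t. conjugate (G t) (diag2 \<omega>))"
      by (auto intro: entire.entries_in_conjugate entire.entries_in_const)
    moreover have "(conjugate (G t) (diag2 \<omega>), conjugate (G t) (diag2 (w t))) \<in> torsion_pairs k (\<omega> + inverse \<omega>)" for t
      by (intro conjugate_torsion_pair diag2_torsion_pair G \<omega> nz w)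
    ultimately show ?thesis
      by (intro exI[of _ "\<lambda>t. conjugate (G t) (diag2 \<omega>)"] exI[of _ "\<lambda>t. conjugate (G t) (diag2 (w t))"])
        (simp add: G g h w)
  qed
qed

lemma irreducible_abelian_piece:
  assumes k: "k > 0" and \<omega>: "\<omega> ^ k = 1" and bezout: "x * q + y * p = (1 :: int)"
  shows "irreducible_in zariski (abelian_piece k p q (\<omega> + inverse \<omega>))"
proof (rule irreducible_in_zariskiI)
  note eq = abelian_piece_eq_torsion_pairs[OF bezout, of k "\<omega> + inverse \<omega>"]
  have "\<omega> \<noteq> 0" using k \<omega> by (auto simp: power_0_left)
  then have "(diag2 \<omega>, diag2 1) \<in> torsion_pairs k (\<omega> + inverse \<omega>)"
    by (intro diag2_torsion_pair \<omega>) auto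
  then show "abelian_piece k p q (\<omega> + inverse \<omega>) \<noteq> {}"
    unfolding eq image_is_empty by (metis empty_iff)
  fix A0 B0 A1 B1
  assume P: "(A0, B0) \<in> abelian_piece k p q (\<omega> + inverse \<omega>)" "(A1, B1) \<in> abelian_piece k p q (\<omega> + inverse \<omega>)"
  from P(1) obtain C0 T0 where P0: "(C0, T0) \<in> torsion_pairs k (\<omega> + inverse \<omega>)"
    "A0 = C0 [^]\<^bsub>SL2\<^esub> y ** T0 [^]\<^bsub>SL2\<^esub> q" "B0 = C0 [^]\<^bsub>SL2\<^esub> (- x) ** T0 [^]\<^bsub>SL2\<^esub> p"
    unfolding eq by auto
  from P(2) obtain C1 T1 where P1: "(C1, T1) \<in> torsion_pairs k (\<omega> + inverse \<omega>)"
    "A1 = C1 [^]\<^bsub>SL2\<^esub> y ** T1 [^]\<^bsub>SL2\<^esub> q" "B1 = C1 [^]\<^bsub>SL2\<^esub> (- x) ** T1 [^]\<^bsub>SL2\<^esub> p"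
    unfolding eq by auto
  obtain C T where CT: "entire.entries_in C" "entire.entries_in T" "C 0 = C0" "T 0 = T0" "C 1 = C1" "T 1 = T1"
    and mem: "\<And>t. (C t, T t) \<in> torsion_pairs k (\<omega> + inverse \<omega>)"
    using torsion_pairs_curve[OF k \<omega> P0(1) P1(1)] by blast
  have det: "det (C t) = 1" "det (T t) = 1" for t using mem[of t] by (auto simp: torsion_pairs_def)
  let ?A = "\<lambda>t. C t [^]\<^bsub>SL2\<^esub> y ** T t [^]\<^bsub>SL2\<^esub> q"
  let ?B = "\<lambda>t. C t [^]\<^bsub>SL2\<^esub> (- x) ** T t [^]\<^bsub>SL2\<^esub> p"
  have "entire.entries_in ?A" "entire.entries_in ?B"
    by (intro entire.entries_in_mult entire.entries_in_int_pow CT det)+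
  moreover have "(?A t, ?B t) \<in> abelian_piece k p q (\<omega> + inverse \<omega>)" for t
    unfolding eq using mem[of t] by (rule rev_image_eqI) simp
  ultimately show "\<exists>A B. entire.entries_in A \<and> entire.entries_in B \<and> A 0 = A0 \<and> B 0 = B0 \<and>
      A 1 = A1 \<and> B 1 = B1 \<and> (\<forall>t. (A t, B t) \<in> abelian_piece k p q (\<omega> + inverse \<omega>))"
    by (intro exI[of _ ?A] exI[of _ ?B]) (simp only: CT P0(2,3) P1(2,3) simp_thms)
qed

lemma Ab_eq_Union:
  assumes k: "k > 0"
  shows "Ab (int k * p) (int k * q) = (\<Union>\<omega>\<in>{\<omega>. \<omega> ^ k = 1}. abelian_piece k p q (\<omega> + inverse \<omega>))"
proof -
  have iff: "(A [^]\<^bsub>SL2\<^esub> p ** B [^]\<^bsub>SL2\<^esub> (- q)) [^]\<^bsub>SL2\<^esub> k = mat 1 \<longleftrightarrow>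
      A [^]\<^bsub>SL2\<^esub> (int k * p) = B [^]\<^bsub>SL2\<^esub> (int k * q)"
    if "det A = 1" "det B = 1" "A ** B = B ** A" for A B
    using SL2.monomial_torsion_iff[of A B p q k] that by simp
  have ev: "\<exists>\<omega>. \<omega> ^ k = 1 \<and> trace C = \<omega> + inverse \<omega>"
    if "det C = 1" "C [^]\<^bsub>SL2\<^esub> k = mat 1" for C
  proof -
    obtain \<omega> where \<omega>: "\<omega> \<noteq> 0" "\<omega> + inverse \<omega> = trace C" using exists_reciprocal_sum by blast
    from scalar_power_cases(1)[OF that k \<omega>(2)[symmetric] \<omega>(1)] \<omega>(2) show ?thesis by metis
  qed
  have "(A, B) \<in> Ab (int k * p) (int k * q) \<longleftrightarrow>
      (\<exists>\<omega>. \<omega> ^ k = 1 \<and> (A, B) \<in> abelian_piece k p q (\<omega> + inverse \<omega>))" for A B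
  proof (cases "det A = 1 \<and> det B = 1 \<and> A ** B = B ** A")
    case True
    then have d: "det (A [^]\<^bsub>SL2\<^esub> p ** B [^]\<^bsub>SL2\<^esub> (- q)) = 1"
      by (simp only: det_mul SL2_int_pow_closed mult_1)
    from True have "(A, B) \<in> Ab (int k * p) (int k * q) \<longleftrightarrow>
        (A [^]\<^bsub>SL2\<^esub> p ** B [^]\<^bsub>SL2\<^esub> (- q)) [^]\<^bsub>SL2\<^esub> k = mat 1"
      using iff[of A B] by (simp only: Ab_eq mem_Collect_eq prod.case rep_variety_iff simp_thms)
    with True ev[OF d] show ?thesis
      unfolding abelian_piece_def mem_Collect_eq prod.case by blast
  next
    case False
    then show ?thesis
      unfolding Ab_eq abelian_piece_def mem_Collect_eq prod.case rep_variety_iff by blast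
  qed
  then show ?thesis by auto
qed

section \<open>Counting the pieces\<close>

text \<open>For \<open>k > 0\<close> and \<open>e = 1\<close> or \<open>e = -1\<close> these are the traces of the nonscalar matrices in \<open>SL(2,\<complex>)\<close> whose
  \<open>k\<close>-th power is \<open>e\<close>.\<close>

definition half_traces :: "nat \<Rightarrow> complex \<Rightarrow> complex set" where
  "half_traces k e = (\<lambda>z. z + inverse z) ` {z. z ^ k = e \<and> z\<^sup>2 \<noteq> 1}"

lemma complex_square_one: "{z::complex. z\<^sup>2 = 1} = {1, - 1}"
  by (auto simp: power2_eq_1_iff)

lemma inverse_sign: "(e::complex)\<^sup>2 = 1 \<Longrightarrow> inverse e = e"
  by (auto simp: power2_eq_1_iff)

lemma root_nonzero: "(z::complex) ^ k = e \<Longrightarrow> e\<^sup>2 = 1 \<Longrightarrow> k > 0 \<Longrightarrow> z \<noteq> 0"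
  by (auto simp: power_0_left)

text \<open>The roots \<open>z\<close> of \<open>z\<^sup>k = e\<close> other than \<open>1\<close> and \<open>-1\<close> come in pairs \<open>z\<close>, \<open>1/z\<close> of two different numbers
  with the same \<open>z + 1/z\<close>.\<close>

lemma card_half_traces:
  assumes k: "k > 0" and e: "e\<^sup>2 = 1"
  shows "finite (half_traces k e)"
    and "2 * card (half_traces k e) + card {z::complex. z\<^sup>2 = 1 \<and> z ^ k = e} = k"
proof -
  let ?L = "{z. z ^ k = e \<and> z\<^sup>2 \<noteq> 1}" and ?f = "\<lambda>z::complex. z + inverse z"
  have e0: "e \<noteq> 0" using e by auto
  have fin: "finite {z. z ^ k = e}" using k by (intro finite_nth_roots) auto
  then have finL: "finite ?L" by (rule rev_finite_subset) auto
  then show "finite (half_traces k e)" by (simp add: half_traces_def)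
  have fiber: "card {x \<in> ?L. ?f x = y} = 2" if "y \<in> ?f ` ?L" for y
  proof -
    from that obtain z where z: "z ^ k = e" "z\<^sup>2 \<noteq> 1" "y = ?f z" by auto
    have z0: "z \<noteq> 0" using root_nonzero[OF z(1) e k] .
    have inv: "inverse z ^ k = e" using z(1) inverse_sign[OF e] by (simp add: power_inverse)
    have "(inverse z)\<^sup>2 \<noteq> 1" using z(2) by (simp add: power_inverse)
    moreover have "?f w = y \<longleftrightarrow> w = z \<or> w = inverse z" if "w \<in> ?L" for w
      using reciprocal_sum_eq_iff[of w z] root_nonzero[of w k e] that e k z0 z(3) by auto
    moreover have "?f (inverse z) = y" using z(3) by simp
    ultimately have "{x \<in> ?L. ?f x = y} = {z, inverse z}" using z inv by blast
    moreover have "z \<noteq> inverse z" using z(2) z0 by (auto simp: power2_eq_square field_simps)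
    ultimately show ?thesis by simp
  qed
  have "card ?L = (\<Sum>x\<in>?L. 1)" by simp
  also have "\<dots> = (\<Sum>y\<in>?f ` ?L. card {x \<in> ?L. ?f x = y})"
    by (subst sum.image_gen[OF finL, of _ ?f]) simp
  also have "\<dots> = (\<Sum>y\<in>?f ` ?L. 2)" by (rule sum.cong[OF HOL.refl fiber])
  also have "\<dots> = 2 * card (half_traces k e)" by (simp add: half_traces_def)
  finally have L: "card ?L = 2 * card (half_traces k e)" .
  have "{z. z ^ k = e} = ?L \<union> {z. z\<^sup>2 = 1 \<and> z ^ k = e}" by auto
  from arg_cong[OF this, of card]
  have "k = card (?L \<union> {z. z\<^sup>2 = 1 \<and> z ^ k = e})" unfolding card_nth_roots[OF e0 k] .
  moreover have "card (?L \<union> {z. z\<^sup>2 = 1 \<and> z ^ k = e}) = card ?L + card {z. z\<^sup>2 = 1 \<and> z ^ k = e}"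
  proof (rule card_Un_disjoint[OF finL])
    show "finite {z. z\<^sup>2 = 1 \<and> z ^ k = e}" using fin by (rule rev_finite_subset) auto
  qed auto
  ultimately show "2 * card (half_traces k e) + card {z::complex. z\<^sup>2 = 1 \<and> z ^ k = e} = k"
    using L by linarith
qed

lemma card_signs:
  "card {z::complex. z\<^sup>2 = 1 \<and> z ^ k = 1} = (if even k then 2 else 1)"
  "card {z::complex. z\<^sup>2 = 1 \<and> z ^ k = - 1} = (if even k then 0 else 1)"
proof -
  have "{z::complex. z\<^sup>2 = 1 \<and> z ^ k = 1} = (if even k then {1, - 1} else {1})"
    by (auto simp: power2_eq_1_iff)
  then show "card {z::complex. z\<^sup>2 = 1 \<and> z ^ k = 1} = (if even k then 2 else 1)" by simp
  have "{z::complex. z\<^sup>2 = 1 \<and> z ^ k = - 1} = (if even k then {} else {- 1})"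
    by (auto simp: power2_eq_1_iff)
  then show "card {z::complex. z\<^sup>2 = 1 \<and> z ^ k = - 1} = (if even k then 0 else 1)" by simp
qed

lemma half_traces_disjoint:
  assumes k: "k > 0"
  shows "half_traces k 1 \<inter> half_traces k (- 1) = {}"
proof -
  have False if z: "z ^ k = 1" and w: "w ^ k = - 1" and eq: "z + inverse z = w + inverse w" for z w :: complex
  proof -
    have "z \<noteq> 0" "w \<noteq> 0" using z w k by (auto simp: power_0_left)
    then have "z = w \<or> z = inverse w" using eq reciprocal_sum_eq_iff by blast
    then show False using z w by (auto simp: power_inverse)
  qed
  then show ?thesis by (auto simp: half_traces_def)
qed

definition trace_index :: "nat \<Rightarrow> nat \<Rightarrow> (complex \<times> complex) set" where
  "trace_index k l = half_traces k 1 \<times> half_traces l 1 \<union> half_traces k (- 1) \<times> half_traces l (- 1)"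

text \<open>Each sign \<open>e\<close> contributes \<open>(k - s)(l - t)/4\<close>, where \<open>s\<close> and \<open>t\<close> are the numbers of elements of
  \<open>{1, -1}\<close> whose \<open>k\<close>-th and \<open>l\<close>-th power, respectively, is \<open>e\<close>.\<close>

lemma card_trace_index:
  assumes k: "k > 0" and l: "l > 0"
  shows "finite (trace_index k l)"
    and "2 * int (card (trace_index k l)) = (int k - 1) * (int l - 1) + (if even k \<and> even l then 1 else 0)"
proof -
  have fin: "finite (half_traces j e)" if "j > 0" "e = 1 \<or> e = - 1" for j e
    using card_half_traces(1)[of j e] that by auto
  show "finite (trace_index k l)" using fin k l by (simp add: trace_index_def)
  have "card (trace_index k l) = card (half_traces k 1) * card (half_traces l 1)
      + card (half_traces k (- 1)) * card (half_traces l (- 1))"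
    unfolding trace_index_def using fin k l half_traces_disjoint[OF k]
    by (subst card_Un_disjoint) (auto simp: card_cartesian_product)
  then have eq: "int (card (trace_index k l)) = int (card (half_traces k 1)) * int (card (half_traces l 1))
      + int (card (half_traces k (- 1))) * int (card (half_traces l (- 1)))"
    by simp
  have h: "2 * int (card (half_traces j 1)) = int j - (if even j then 2 else 1)"
    "2 * int (card (half_traces j (- 1))) = int j - (if even j then 0 else 1)" if "j > 0" for j
    using card_half_traces(2)[OF that, of 1] card_half_traces(2)[OF that, of "- 1"] card_signs[of j] by auto
  have "2 * (2 * int (card (trace_index k l))) =
      (2 * int (card (half_traces k 1))) * (2 * int (card (half_traces l 1)))
      + (2 * int (card (half_traces k (- 1)))) * (2 * int (card (half_traces l (- 1))))"
    unfolding eq by (simp add: algebra_simps)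
  also have "\<dots> = 2 * ((int k - 1) * (int l - 1) + (if even k \<and> even l then 1 else 0))"
    unfolding h[OF k] h[OF l] by (auto simp: algebra_simps)
  finally show "2 * int (card (trace_index k l)) = (int k - 1) * (int l - 1) + (if even k \<and> even l then 1 else 0)"
    by simp
qed

definition root_traces :: "nat \<Rightarrow> complex set" where
  "root_traces k = (\<lambda>\<omega>. \<omega> + inverse \<omega>) ` {\<omega>. \<omega> ^ k = 1}"

lemma card_root_traces:
  assumes k: "k > 0"
  shows "finite (root_traces k)" and "2 * card (root_traces k) = k + (if even k then 2 else 1)"
proof -
  let ?f = "\<lambda>z::complex. z + inverse z" and ?S = "{z::complex. z\<^sup>2 = 1 \<and> z ^ k = 1}"
  show "finite (root_traces k)"
    unfolding root_traces_def using k by (intro finite_imageI finite_nth_roots) auto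
  have S: "?S \<subseteq> {1, - 1}" using complex_square_one by auto
  have "root_traces k = half_traces k 1 \<union> ?f ` ?S" by (auto simp: root_traces_def half_traces_def)
  moreover have "half_traces k 1 \<inter> ?f ` ?S = {}"
  proof -
    have False if z: "z ^ k = 1" "z\<^sup>2 \<noteq> 1" and w: "w\<^sup>2 = 1" and eq: "?f z = ?f w" for z w
    proof -
      have "z \<noteq> 0" "w \<noteq> 0" using root_nonzero[OF z(1) _ k] w by auto
      then have "z = w \<or> z = inverse w" using eq reciprocal_sum_eq_iff by blast
      then show False using z(2) w inverse_sign[OF w] by auto
    qed
    then show ?thesis by (auto simp: half_traces_def)
  qed
  moreover have "finite ?S" using S by (rule finite_subset) auto
  ultimately have "card (root_traces k) = card (half_traces k 1) + card (?f ` ?S)"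
    using card_half_traces(1)[OF k, of 1] by (simp add: card_Un_disjoint)
  moreover have "inj_on ?f ?S"
  proof (rule inj_onI)
    fix x y assume "x \<in> ?S" "y \<in> ?S" and eq: "?f x = ?f y"
    then have "x = 1 \<or> x = - 1" "y = 1 \<or> y = - 1" using S by blast+
    with eq show "x = y" by auto
  qed
  then have "card (?f ` ?S) = card ?S" by (rule card_image)
  ultimately show "2 * card (root_traces k) = k + (if even k then 2 else 1)"
    using card_half_traces(2)[OF k, of 1] card_signs(1)[of k] by simp
qed

section \<open>The decomposition of the representation variety\<close>

definition trace_pieces :: "int \<Rightarrow> int \<Rightarrow> matrix_pair set set" where
  "trace_pieces m n = (\<lambda>(a, b). trace_piece a b) ` trace_index (nat \<bar>m\<bar>) (nat \<bar>n\<bar>)"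

definition abelian_pieces :: "nat \<Rightarrow> int \<Rightarrow> int \<Rightarrow> matrix_pair set set" where
  "abelian_pieces k p q = abelian_piece k p q ` root_traces k"

lemma trace_index_cases:
  assumes "(a, b) \<in> trace_index k l" and k: "k > 0" and l: "l > 0"
  obtains e z w where "e\<^sup>2 = 1" "z ^ k = e" "z \<noteq> 0" "z\<^sup>2 \<noteq> 1" "w ^ l = e" "w \<noteq> 0" "w\<^sup>2 \<noteq> 1"
    "a = z + inverse z" "b = w + inverse w"
proof -
  obtain e where e: "e = 1 \<or> e = - 1" "a \<in> half_traces k e" "b \<in> half_traces l e"
    using assms(1) by (auto simp: trace_index_def)
  then obtain z w where zw: "z ^ k = e" "z\<^sup>2 \<noteq> 1" "w ^ l = e" "w\<^sup>2 \<noteq> 1" "a = z + inverse z" "b = w + inverse w"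
    by (auto simp: half_traces_def)
  have e2: "e\<^sup>2 = 1" using e(1) by auto
  show ?thesis using that[OF e2 zw(1) _ zw(2,3) _ zw(4-6)] root_nonzero zw(1,3) e2 k l by blast
qed

lemma trace_piece_disjoint: "trace_piece a b \<inter> trace_piece a' b' = {} \<or> a = a' \<and> b = b'"
  by (auto simp: trace_piece_def)

lemma abelian_piece_disjoint: "abelian_piece k p q c \<inter> abelian_piece k p q c' = {} \<or> c = c'"
  by (auto simp: abelian_piece_def)

context
  fixes m n :: int
  assumes m: "m \<noteq> 0" and n: "n \<noteq> 0"
begin

lemma closedin_trace_pieces: "X \<in> trace_pieces m n \<Longrightarrow> closedin zariski X"
  by (auto simp: trace_pieces_def closedin_trace_piece)

lemma trace_pieces_properties:
  assumes "X \<in> trace_pieces m n"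
  shows "irreducible_in zariski X" "X \<subseteq> rep_variety m n"
    and "\<exists>A B. (A, B) \<in> X \<and> det (A ** B - B ** A) \<noteq> 0"
proof -
  obtain a b where X: "X = trace_piece a b" "(a, b) \<in> trace_index (nat \<bar>m\<bar>) (nat \<bar>n\<bar>)"
    using assms by (auto simp: trace_pieces_def)
  obtain e z w where "e\<^sup>2 = 1" "z ^ nat \<bar>m\<bar> = e" "z \<noteq> 0" "z\<^sup>2 \<noteq> 1" "w ^ nat \<bar>n\<bar> = e" "w \<noteq> 0" "w\<^sup>2 \<noteq> 1"
    and ab: "a = z + inverse z" "b = w + inverse w"
    using trace_index_cases[OF X(2)] m n by auto
  note zw = this(1-7)
  show "irreducible_in zariski X" unfolding X(1) ab by (rule irreducible_trace_piece) fact+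
  show "X \<subseteq> rep_variety m n" unfolding X(1) ab by (rule trace_piece_subset) fact+
  show "\<exists>A B. (A, B) \<in> X \<and> det (A ** B - B ** A) \<noteq> 0"
    unfolding X(1) ab using trace_piece_generic_point[OF zw(3,4), of "w + inverse w"] by blast
qed

lemma finite_trace_pieces: "finite (trace_pieces m n)"
  unfolding trace_pieces_def using m n by (intro finite_imageI card_trace_index) auto

lemma noncommuting_in_trace_pieces:
  assumes "(A, B) \<in> rep_variety m n" "A ** B \<noteq> B ** A"
  shows "(A, B) \<in> \<Union>(trace_pieces m n)"
proof -
  obtain e z w where e: "e\<^sup>2 = 1" and z: "z ^ nat \<bar>m\<bar> = e" "z\<^sup>2 \<noteq> 1" and w: "w ^ nat \<bar>n\<bar> = e" "w\<^sup>2 \<noteq> 1"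
    and P: "(A, B) \<in> trace_piece (z + inverse z) (w + inverse w)"
    using noncommuting_trace_piece[OF m n assms] .
  have "e = 1 \<or> e = - 1" using e by (simp add: power2_eq_1_iff)
  with z w have "(z + inverse z, w + inverse w) \<in> trace_index (nat \<bar>m\<bar>) (nat \<bar>n\<bar>)"
    unfolding trace_index_def half_traces_def by auto
  with P show ?thesis by (auto simp: trace_pieces_def)
qed

text \<open>On an irreducible trace piece the polynomial \<open>det (A B - B A)\<close> is not identically zero, and where
  it does not vanish the representation is irreducible. Hence the piece is contained in the closure of
  \<open>Irr\<close>.\<close>

lemma closure_Irr: "zariski closure_of Irr m n = \<Union>(trace_pieces m n)"
proof
  have "Irr m n \<subseteq> \<Union>(trace_pieces m n)"
    using Irr_noncommuting noncommuting_in_trace_pieces by auto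
  moreover have "closedin zariski (\<Union>(trace_pieces m n))"
    by (intro closedin_Union finite_trace_pieces closedin_trace_pieces)
  ultimately show "zariski closure_of Irr m n \<subseteq> \<Union>(trace_pieces m n)"
    by (rule closure_of_minimal)
  show "\<Union>(trace_pieces m n) \<subseteq> zariski closure_of Irr m n"
  proof (rule Union_least)
    fix X assume X: "X \<in> trace_pieces m n"
    note props = trace_pieces_properties[OF X]
    let ?D = "{P. det (fst P ** snd P - snd P ** fst P) = 0}"
    have "closedin zariski ?D"
      by (intro closedin_zariski_zero poly.det_in poly.entries_in_diff poly.entries_in_mult
          poly_entries_fst poly_entries_snd)
    moreover have "closedin zariski (zariski closure_of Irr m n)" by (rule closedin_closure_of)
    moreover have "X \<subseteq> zariski closure_of Irr m n \<union> ?D"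
    proof clarsimp
      fix A B assume P: "(A, B) \<in> X" "(A, B) \<notin> zariski closure_of Irr m n"
      have "Irr m n \<subseteq> zariski closure_of Irr m n" by (rule closure_of_subset) simp
      with P have "(A, B) \<notin> Irr m n" by blast
      with P(1) props(2) show "det (A ** B - B ** A) = 0"
        using det_commutator_imp_Irr by blast
    qed
    moreover have "\<not> X \<subseteq> ?D" using props(3) by auto
    ultimately show "X \<subseteq> zariski closure_of Irr m n"
      using props(1) unfolding irreducible_in_def by blast
  qed
qed

lemma trace_pieces_antichain:
  assumes "X \<in> trace_pieces m n" "Y \<in> trace_pieces m n" "X \<subseteq> Y"
  shows "X = Y"
proof -
  obtain a b a' b' where XY: "X = trace_piece a b" "Y = trace_piece a' b'"
    using assms(1,2) by (auto simp: trace_pieces_def)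
  have "X \<inter> Y \<noteq> {}" using assms(3) trace_pieces_properties(3)[OF assms(1)] by auto
  with trace_piece_disjoint[of a b a' b'] show ?thesis by (auto simp: XY)
qed

lemma card_trace_pieces: "card (trace_pieces m n) = card (trace_index (nat \<bar>m\<bar>) (nat \<bar>n\<bar>))"
  unfolding trace_pieces_def
proof (intro card_image inj_onI, clarify)
  fix a b a' b'
  assume ab: "(a, b) \<in> trace_index (nat \<bar>m\<bar>) (nat \<bar>n\<bar>)" and eq: "trace_piece a b = trace_piece a' b'"
  have "trace_piece a b \<in> trace_pieces m n" using ab by (force simp: trace_pieces_def)
  from trace_pieces_properties(3)[OF this] have "trace_piece a b \<noteq> {}" by auto
  with eq trace_piece_disjoint[of a b a' b'] show "a = a' \<and> b = b'" by auto
qed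

end

context
  fixes k :: nat and p q x y :: int
  assumes k: "k > 0" and bezout: "x * q + y * p = 1" and q: "q \<noteq> 0"
begin

text \<open>The last property separates an abelian piece from the trace pieces, where the eigenvalues of
  \<open>A\<close> are roots of unity. The witness is \<open>C\<close> diagonal with first entry \<open>\<omega>\<close> and \<open>T\<close> diagonal with first entry
  \<open>2\<close>:
  then \<open>v = \<omega>\<^sup>y 2\<^sup>q\<close> is an eigenvalue of \<open>A\<close> of absolute value \<open>2\<^sup>q\<close>.\<close>

lemma abelian_pieces_properties:
  assumes "X \<in> abelian_pieces k p q"
  shows "irreducible_in zariski X" "closedin zariski X" "X \<noteq> {}"
    and "(A, B) \<in> X \<Longrightarrow> A ** B = B ** A"
    and "\<exists>v A B. v \<noteq> 0 \<and> norm v \<noteq> 1 \<and> (A, B) \<in> X \<and> trace A = v + inverse v"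
proof -
  obtain \<omega> where \<omega>: "\<omega> ^ k = 1" and X: "X = abelian_piece k p q (\<omega> + inverse \<omega>)"
    using assms by (auto simp: abelian_pieces_def root_traces_def)
  show irr: "irreducible_in zariski X" unfolding X by (rule irreducible_abelian_piece[OF k \<omega> bezout])
  then show "X \<noteq> {}" by (simp add: irreducible_in_def)
  show "closedin zariski X" unfolding X by (rule closedin_abelian_piece)
  show "(A, B) \<in> X \<Longrightarrow> A ** B = B ** A" by (simp add: X abelian_piece_def)
  have \<omega>0: "\<omega> \<noteq> 0" using \<omega> k by (auto simp: power_0_left)
  define v where "v = \<omega> powi y * 2 powi q"
  have v0: "v \<noteq> 0" using \<omega>0 by (simp add: v_def)
  have "norm \<omega> = 1" using power_eq_1_iff[OF \<omega>] k by simp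
  then have "norm v = 2 powi q" by (simp add: v_def norm_mult norm_power_int)
  moreover have "(2::real) powi q \<noteq> 1" using q
    using power_int_strict_increasing[of q 0 "2::real"] power_int_strict_increasing[of 0 q "2::real"]
    by (cases q "0::int" rule: linorder_cases) simp_all
  moreover have "(diag2 \<omega>, diag2 2) \<in> torsion_pairs k (\<omega> + inverse \<omega>)"
    by (rule diag2_torsion_pair) (use \<omega> \<omega>0 in auto)
  then have "(diag2 \<omega> [^]\<^bsub>SL2\<^esub> y ** diag2 2 [^]\<^bsub>SL2\<^esub> q, diag2 \<omega> [^]\<^bsub>SL2\<^esub> (- x) ** diag2 2 [^]\<^bsub>SL2\<^esub> p) \<in> X"
    unfolding X abelian_piece_eq_torsion_pairs[OF bezout] by (rule rev_image_eqI) simp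
  moreover have "diag2 \<omega> [^]\<^bsub>SL2\<^esub> y ** diag2 2 [^]\<^bsub>SL2\<^esub> q = diag2 v"
    using diag2_int_pow[OF \<omega>0, of y] diag2_int_pow[of 2 q] by (simp add: diag2_mult v_def)
  moreover have "trace (diag2 v) = v + inverse v" by (simp add: diag2_def trace_mat2)
  ultimately show "\<exists>v A B. v \<noteq> 0 \<and> norm v \<noteq> 1 \<and> (A, B) \<in> X \<and> trace A = v + inverse v"
    using v0 by metis
qed

lemma finite_abelian_pieces: "finite (abelian_pieces k p q)"
  by (simp add: abelian_pieces_def card_root_traces(1)[OF k])

lemma abelian_pieces_antichain:
  assumes "X \<in> abelian_pieces k p q" "Y \<in> abelian_pieces k p q" "X \<subseteq> Y"
  shows "X = Y"
proof -
  obtain c c' where XY: "X = abelian_piece k p q c" "Y = abelian_piece k p q c'"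
    using assms(1,2) by (auto simp: abelian_pieces_def)
  have "X \<inter> Y \<noteq> {}" using assms(3) abelian_pieces_properties(3)[OF assms(1)] by auto
  with abelian_piece_disjoint[of k p q c c'] show ?thesis by (auto simp: XY)
qed

lemma card_abelian_pieces: "card (abelian_pieces k p q) = card (root_traces k)"
  unfolding abelian_pieces_def
proof (intro card_image inj_onI)
  fix c c' assume c: "c \<in> root_traces k" and eq: "abelian_piece k p q c = abelian_piece k p q c'"
  have "abelian_piece k p q c \<noteq> {}"
    using abelian_pieces_properties(3) c by (auto simp: abelian_pieces_def)
  with eq abelian_piece_disjoint[of k p q c c'] show "c = c'" by auto
qed

lemma Ab_eq_Union_pieces: "Ab (int k * p) (int k * q) = \<Union>(abelian_pieces k p q)"
  by (auto simp: Ab_eq_Union[OF k] abelian_pieces_def root_traces_def)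

end

lemma norm_trace_index:
  assumes "(a, b) \<in> trace_index k l" "k > 0" "l > 0" "v \<noteq> 0" "a = v + inverse v"
  shows "norm v = 1"
proof -
  obtain e z w where e: "e\<^sup>2 = 1" "z ^ k = e" "z \<noteq> 0" "a = z + inverse z"
    using trace_index_cases[OF assms(1-3)] by metis
  have "norm e = 1" using e(1) by (auto simp: power2_eq_1_iff)
  then have "norm z ^ k = 1" using e(2) by (simp add: norm_power[symmetric])
  then have "norm z = 1" using assms(2) power_eq_imp_eq_base[of "norm z" k 1] by simp
  moreover have "v = z \<or> v = inverse z" using assms(4,5) e(3,4) reciprocal_sum_eq_iff by metis
  ultimately show ?thesis by (auto simp: norm_inverse)
qed

theorem theorem7p8:
  fixes m n d :: int
  assumes "m \<noteq> 0" and "n \<noteq> 0" and d: "d = gcd m n"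
  shows "finite (irreducible_components zariski (rep_variety m n)) \<and>
    finite (irreducible_components zariski (zariski closure_of Irr m n)) \<and>
    finite (irreducible_components zariski (Ab m n)) \<and>
    (odd d \<longrightarrow>
      real (card (irreducible_components zariski (rep_variety m n)))
        = real_of_int ((\<bar>m\<bar> - 1) * (\<bar>n\<bar> - 1)) / 2 + real_of_int (d + 1) / 2 \<and>
      real (card (irreducible_components zariski (zariski closure_of Irr m n)))
        = real_of_int ((\<bar>m\<bar> - 1) * (\<bar>n\<bar> - 1)) / 2 \<and>
      real (card (irreducible_components zariski (Ab m n))) = real_of_int (d + 1) / 2) \<and>
    (even d \<longrightarrow>
      real (card (irreducible_components zariski (rep_variety m n)))
        = real_of_int ((\<bar>m\<bar> - 1) * (\<bar>n\<bar> - 1) + 1) / 2 + real_of_int (d + 2) / 2 \<and>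
      real (card (irreducible_components zariski (zariski closure_of Irr m n)))
        = real_of_int ((\<bar>m\<bar> - 1) * (\<bar>n\<bar> - 1) + 1) / 2 \<and>
      real (card (irreducible_components zariski (Ab m n))) = real_of_int (d + 2) / 2)"
proof -
  note mn = assms(1,2)
  define k where "k = nat d"
  have dpos: "d > 0" using mn by (simp add: d)
  then have k: "k > 0" and kd: "int k = d" by (simp_all add: k_def)
  define p q where "p = m div d" and "q = n div d"
  have pq: "m = int k * p" "n = int k * q" by (simp_all add: kd p_def q_def d)
  obtain y x where "y * m + x * n = d" unfolding d using bezout_int by blast
  then have "int k * (x * q + y * p) = int k * 1"
    unfolding kd[symmetric] by (subst (asm) pq(1), subst (asm) pq(2)) (simp add: algebra_simps)
  then have bezout: "x * q + y * p = 1" using k by simp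
  have q: "q \<noteq> 0" using mn(2) pq(2) by auto
  let ?\<T> = "trace_pieces m n" and ?\<A> = "abelian_pieces k p q"
  note T = trace_pieces_properties[OF mn] and A = abelian_pieces_properties[OF k bezout q]
  note finT = finite_trace_pieces[OF mn] and finA = finite_abelian_pieces[OF k bezout q]
  have closedT: "closedin zariski X" if "X \<in> ?\<T>" for X using closedin_trace_pieces[OF mn that] .
  have Ab: "Ab m n = \<Union>?\<A>" using Ab_eq_Union_pieces[OF k bezout q] by (simp only: pq[symmetric])
  have TA: "\<not> X \<subseteq> Y" if X: "X \<in> ?\<T>" and Y: "Y \<in> ?\<A>" for X Y
  proof
    assume sub: "X \<subseteq> Y"
    obtain A B where "(A, B) \<in> X" "det (A ** B - B ** A) \<noteq> 0" using T(3)[OF X] by blast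
    moreover from this sub have "A ** B = B ** A" using A(4)[OF Y] by blast
    ultimately show False by (simp add: det_2)
  qed
  have AT: "\<not> Y \<subseteq> X" if X: "X \<in> ?\<T>" and Y: "Y \<in> ?\<A>" for X Y
  proof
    assume sub: "Y \<subseteq> X"
    obtain v A B where v: "v \<noteq> 0" "norm v \<noteq> 1" "(A, B) \<in> Y" "trace A = v + inverse v"
      using A(5)[OF Y] by blast
    obtain a b where ab: "X = trace_piece a b" "(a, b) \<in> trace_index (nat \<bar>m\<bar>) (nat \<bar>n\<bar>)"
      using X by (auto simp: trace_pieces_def)
    have "a = v + inverse v" using v(3,4) sub by (auto simp: ab trace_piece_def)
    from norm_trace_index[OF ab(2) _ _ v(1) this] mn v(2) show False by simp
  qed
  have disj: "?\<T> \<inter> ?\<A> = {}" using TA by blast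
  have rep: "rep_variety m n = \<Union>(?\<T> \<union> ?\<A>)"
  proof
    show "rep_variety m n \<subseteq> \<Union>(?\<T> \<union> ?\<A>)"
    proof clarify
      fix A B assume R: "(A, B) \<in> rep_variety m n"
      show "(A, B) \<in> \<Union>(?\<T> \<union> ?\<A>)"
      proof (cases "A ** B = B ** A")
        case True
        with R have "(A, B) \<in> Ab m n" by (simp add: Ab_eq)
        then show ?thesis unfolding Ab by blast
      next
        case False
        from noncommuting_in_trace_pieces[OF mn R this] show ?thesis by blast
      qed
    qed
    have "Ab m n \<subseteq> rep_variety m n" by (auto simp: Ab_eq)
    then show "\<Union>(?\<T> \<union> ?\<A>) \<subseteq> rep_variety m n" using T(2) unfolding Ab by blast
  qed
  have compR: "irreducible_components zariski (rep_variety m n) = ?\<T> \<union> ?\<A>"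
    unfolding rep
  proof (rule irreducible_components_Union)
    fix X Y assume "X \<in> ?\<T> \<union> ?\<A>" "Y \<in> ?\<T> \<union> ?\<A>" and sub: "X \<subseteq> Y"
    then consider "X \<in> ?\<T>" "Y \<in> ?\<T>" | "X \<in> ?\<T>" "Y \<in> ?\<A>"
      | "X \<in> ?\<A>" "Y \<in> ?\<T>" | "X \<in> ?\<A>" "Y \<in> ?\<A>" by blast
    then show "X = Y"
    proof cases
      case 1
      then show ?thesis using trace_pieces_antichain[OF mn _ _ sub] by simp
    next
      case 2
      then show ?thesis using TA sub by metis
    next
      case 3
      then show ?thesis using AT sub by metis
    next
      case 4
      then show ?thesis using abelian_pieces_antichain[OF k bezout q _ _ sub] by simp
    qed
  qed (use finT finA T(1) A(1,2) closedT in auto)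
  have compI: "irreducible_components zariski (zariski closure_of Irr m n) = ?\<T>"
    unfolding closure_Irr[OF mn]
    by (rule irreducible_components_Union) (use finT T(1) closedT trace_pieces_antichain[OF mn] in auto)
  have compA: "irreducible_components zariski (Ab m n) = ?\<A>"
    unfolding Ab
    by (rule irreducible_components_Union)
      (use finA A(1,2) abelian_pieces_antichain[OF k bezout q] in auto)
  have even: "even (nat \<bar>m\<bar>) \<and> even (nat \<bar>n\<bar>) \<longleftrightarrow> even d"
    by (simp add: d even_nat_iff)
  have "2 * int (card ?\<T>) = (\<bar>m\<bar> - 1) * (\<bar>n\<bar> - 1) + (if even d then 1 else 0)"
    using card_trace_index(2)[of "nat \<bar>m\<bar>" "nat \<bar>n\<bar>"] mn
    by (simp only: card_trace_pieces[OF mn] even) simp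
  then have "real_of_int (2 * int (card ?\<T>)) = real_of_int ((\<bar>m\<bar> - 1) * (\<bar>n\<bar> - 1) + (if even d then 1 else 0))"
    by (simp only:)
  then have cardT: "real (card ?\<T>) = real_of_int ((\<bar>m\<bar> - 1) * (\<bar>n\<bar> - 1) + (if even d then 1 else 0)) / 2"
    by simp
  have "2 * int (card ?\<A>) = d + (if even d then 2 else 1)"
    using card_root_traces(2)[OF k]
    by (cases "even k") (simp_all add: card_abelian_pieces[OF k bezout q] kd[symmetric])
  then have "real_of_int (2 * int (card ?\<A>)) = real_of_int (d + (if even d then 2 else 1))"
    by (simp only:)
  then have cardA: "real (card ?\<A>) = real_of_int (d + (if even d then 2 else 1)) / 2"
    by simp
  have cardR: "real (card (?\<T> \<union> ?\<A>)) = real (card ?\<T>) + real (card ?\<A>)"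
    using finT finA disj by (simp add: card_Un_disjoint)
  show ?thesis
    unfolding compR compI compA cardR cardT cardA using finT finA by simp
qed

end
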